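(* Assuming Church's thesis, for every $P:\mathcal U$ there is an equivalence $\mathsf{SemiDecision}(P)\simeq\operatorname{rosoliniStructure}(P)$.
   Context: Type theory: Martin-Löf type theory with universe $\mathcal U$, function extensionality, proposition extensionality and propositional truncations. For $f:\mathbb N\to 2$, $\langle f\rangle:=\sum_n(f_n=1)$; $\mathbb N_\infty:=\sum_{f:\mathbb N\to2}\operatorname{isProp}\langle f\rangle$; $\operatorname{rosoliniStructure}(P):=\sum_{u:\mathbb N_\infty}(P=\langle u\rangle)$. $\mathsf{SemiDecision}(P):=\sum_{f:\mathbb N\to 2}\operatorname{isProp}\langle f\rangle\times\mathsf{isComputable}(f)\times(P\simeq\langle f\rangle)$, where a total $f$ is computable if $\eta\circ f$ (viewing $2\subseteq\mathbb N$) is. Computability: a recursive machine is a pair $m=(i,s)$ of unary primitive recursive functions, $s$ read as $\mathbb N\to\mathbb N+\mathbb N$ via $\mathrm{inl}(n)=2n$, $\mathrm{inr}(n)=2n+1$; $\operatorname{run}_k(m,x):=s'^k(\mathrm{inl}(i(x)))$ where $s'(\mathrm{inl}\,x)=s(x)$, $s'(\mathrm{inr}\,y)=\mathrm{inr}\,y$; $\operatorname{eval}(m)(x)\in\mathcal L(\mathbb N)$ has extent $\sum_y\lVert\sum_k\operatorname{run}_k(m,x)=\mathrm{inr}\,y\rVert$ and value the first projection; $\mathsf{isComputable}(g):=\lVert\sum_m g=\operatorname{eval}(m)\rVert$ for $g:\mathbb N\to\mathcal L(\mathbb N)$, where $\mathcal L(Y):=\sum_{P:\mathcal U}\operatorname{isProp}(P)\times(P\to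 Y)$ and $\eta(y)=(1,-,\lambda u.y)$. Church's thesis: for all $g:\mathbb N\to\mathbb N$, $\mathsf{isComputable}(\eta\circ g)$. *)

theory Defs
  imports Main
begin

text \<open>
  Church's thesis is refutable in HOL, so the result is stated about derivability in a
  deeply embedded type theory: intensional Martin-Loef type theory with \<open>\<Pi>\<close>, \<open>\<Sigma>\<close>, \<open>+\<close>, \<open>0\<close>,
  \<open>1\<close>, \<open>2\<close>, \<open>\<nat>\<close>, identity types and one universe a la Russell, extended by propositional
  truncation, function extensionality and proposition extensionality as constants.
  ``There is an element of \<open>A\<close>'' means that some closed term has type \<open>A\<close>.
\<close>

section \<open>Raw syntax\<close>

text \<open>
  De Bruijn indices. The binding positions are the second argument of \<open>Pi\<close>, \<open>Lam\<close>, \<open>Sig\<close>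
  and the motive (first argument) of \<open>Split\<close>, \<open>Case\<close>, \<open>UnitElim\<close>, \<open>TwoElim\<close>, \<open>NatElim\<close>, which
  bind one variable, and the motive of \<open>J\<close>, which binds two.
\<close>

datatype tm =
    Var nat
  | Univ
  | Pi tm tm | Lam tm tm | App tm tm
  | Sig tm tm | Pair tm tm | Split tm tm tm
  | Sum tm tm | InL tm | InR tm | Case tm tm tm tm
  | Empty | Absurd tm tm
  | Unit | Star | UnitElim tm tm tm
  | Two | Two0 | Two1 | TwoElim tm tm tm tm
  | Nat | Zero | Succ tm | NatElim tm tm tm tm
  | Eq tm tm tm | Refl tm | J tm tm tm
  | Trunc tm | TruncIn tm | TruncProp tm | TruncElim tm tm tm
  | FunExt tm
  | PropExt tm tm tm tm

text \<open>\<open>lift k t\<close> makes room for a fresh variable with index \<open>k\<close>.\<close>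

primrec lift :: "nat \<Rightarrow> tm \<Rightarrow> tm" where
  "lift k (Var i) = (if i < k then Var i else Var (Suc i))"
| "lift k Univ = Univ"
| "lift k (Pi A B) = Pi (lift k A) (lift (Suc k) B)"
| "lift k (Lam A b) = Lam (lift k A) (lift (Suc k) b)"
| "lift k (App f a) = App (lift k f) (lift k a)"
| "lift k (Sig A B) = Sig (lift k A) (lift (Suc k) B)"
| "lift k (Pair a b) = Pair (lift k a) (lift k b)"
| "lift k (Split C d p) = Split (lift (Suc k) C) (lift k d) (lift k p)"
| "lift k (Sum A B) = Sum (lift k A) (lift k B)"
| "lift k (InL a) = InL (lift k a)"
| "lift k (InR b) = InR (lift k b)"
| "lift k (Case C l r t) = Case (lift (Suc k) C) (lift k l) (lift k r) (lift k t)"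
| "lift k Empty = Empty"
| "lift k (Absurd C t) = Absurd (lift k C) (lift k t)"
| "lift k Unit = Unit"
| "lift k Star = Star"
| "lift k (UnitElim C c t) = UnitElim (lift (Suc k) C) (lift k c) (lift k t)"
| "lift k Two = Two"
| "lift k Two0 = Two0"
| "lift k Two1 = Two1"
| "lift k (TwoElim C a b t) = TwoElim (lift (Suc k) C) (lift k a) (lift k b) (lift k t)"
| "lift k Nat = Nat"
| "lift k Zero = Zero"
| "lift k (Succ n) = Succ (lift k n)"
| "lift k (NatElim C z s n) = NatElim (lift (Suc k) C) (lift k z) (lift k s) (lift k n)"
| "lift k (Eq A a b) = Eq (lift k A) (lift k a) (lift k b)"
| "lift k (Refl a) = Refl (lift k a)"
| "lift k (J C d p) = J (lift (Suc (Suc k)) C) (lift k d) (lift k p)"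
| "lift k (Trunc A) = Trunc (lift k A)"
| "lift k (TruncIn a) = TruncIn (lift k a)"
| "lift k (TruncProp A) = TruncProp (lift k A)"
| "lift k (TruncElim h f t) = TruncElim (lift k h) (lift k f) (lift k t)"
| "lift k (FunExt h) = FunExt (lift k h)"
| "lift k (PropExt p q f g) = PropExt (lift k p) (lift k q) (lift k f) (lift k g)"

text \<open>\<open>subst k u t\<close> replaces the variable with index \<open>k\<close> by \<open>u\<close> and closes the gap.\<close>

primrec subst :: "nat \<Rightarrow> tm \<Rightarrow> tm \<Rightarrow> tm" where
  "subst k u (Var i) = (if i < k then Var i else if i = k then u else Var (i - 1))"
| "subst k u Univ = Univ"
| "subst k u (Pi A B) = Pi (subst k u A) (subst (Suc k) (lift 0 u) B)"
| "subst k u (Lam A b) = Lam (subst k u A) (subst (Suc k) (lift 0 u) b)"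
| "subst k u (App f a) = App (subst k u f) (subst k u a)"
| "subst k u (Sig A B) = Sig (subst k u A) (subst (Suc k) (lift 0 u) B)"
| "subst k u (Pair a b) = Pair (subst k u a) (subst k u b)"
| "subst k u (Split C d p) =
     Split (subst (Suc k) (lift 0 u) C) (subst k u d) (subst k u p)"
| "subst k u (Sum A B) = Sum (subst k u A) (subst k u B)"
| "subst k u (InL a) = InL (subst k u a)"
| "subst k u (InR b) = InR (subst k u b)"
| "subst k u (Case C l r t) =
     Case (subst (Suc k) (lift 0 u) C) (subst k u l) (subst k u r) (subst k u t)"
| "subst k u Empty = Empty"
| "subst k u (Absurd C t) = Absurd (subst k u C) (subst k u t)"
| "subst k u Unit = Unit"
| "subst k u Star = Star"
| "subst k u (UnitElim C c t) =
     UnitElim (subst (Suc k) (lift 0 u) C) (subst k u c) (subst k u t)"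
| "subst k u Two = Two"
| "subst k u Two0 = Two0"
| "subst k u Two1 = Two1"
| "subst k u (TwoElim C a b t) =
     TwoElim (subst (Suc k) (lift 0 u) C) (subst k u a) (subst k u b) (subst k u t)"
| "subst k u Nat = Nat"
| "subst k u Zero = Zero"
| "subst k u (Succ n) = Succ (subst k u n)"
| "subst k u (NatElim C z s n) =
     NatElim (subst (Suc k) (lift 0 u) C) (subst k u z) (subst k u s) (subst k u n)"
| "subst k u (Eq A a b) = Eq (subst k u A) (subst k u a) (subst k u b)"
| "subst k u (Refl a) = Refl (subst k u a)"
| "subst k u (J C d p) =
     J (subst (Suc (Suc k)) (lift 0 (lift 0 u)) C) (subst k u d) (subst k u p)"
| "subst k u (Trunc A) = Trunc (subst k u A)"
| "subst k u (TruncIn a) = TruncIn (subst k u a)"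
| "subst k u (TruncProp A) = TruncProp (subst k u A)"
| "subst k u (TruncElim h f t) = TruncElim (subst k u h) (subst k u f) (subst k u t)"
| "subst k u (FunExt h) = FunExt (subst k u h)"
| "subst k u (PropExt p q f g) =
     PropExt (subst k u p) (subst k u q) (subst k u f) (subst k u g)"

abbreviation inst :: "tm \<Rightarrow> tm \<Rightarrow> tm" where
  "inst B a \<equiv> subst 0 a B"

text \<open>For \<open>B\<close> in \<open>\<Gamma>, x\<close>: instantiate \<open>x\<close> by a term \<open>a\<close> that lives in \<open>\<Gamma>, y\<close> or in \<open>\<Gamma>, y, z\<close>.\<close>

abbreviation inst_under1 :: "tm \<Rightarrow> tm \<Rightarrow> tm" where
  "inst_under1 B a \<equiv> subst 0 a (lift 1 B)"

abbreviation inst_under2 :: "tm \<Rightarrow> tm \<Rightarrow> tm" where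
  "inst_under2 B a \<equiv> subst 0 a (lift 1 (lift 1 B))"

text \<open>For \<open>C\<close> in \<open>\<Gamma>, x, p\<close>: instantiate \<open>x\<close> by \<open>a\<close> and \<open>p\<close> by \<open>e\<close>, both living in \<open>\<Gamma>\<close>.\<close>

abbreviation inst2 :: "tm \<Rightarrow> tm \<Rightarrow> tm \<Rightarrow> tm" where
  "inst2 C a e \<equiv> subst 0 a (subst 0 (lift 0 e) C)"

abbreviation Arr :: "tm \<Rightarrow> tm \<Rightarrow> tm" where
  "Arr A B \<equiv> Pi A (lift 0 B)"

definition IsProp :: "tm \<Rightarrow> tm" where
  "IsProp A = Pi A (Pi (lift 0 A) (Eq (lift 0 (lift 0 A)) (Var 1) (Var 0)))"


section \<open>Definitional equality\<close>

text \<open>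
  The congruence generated by the computation rules, on raw terms. There are no \<open>\<eta>\<close>-rules, and no
  computation rules for truncation or for the two extensionality constants.
\<close>

inductive conv :: "tm \<Rightarrow> tm \<Rightarrow> bool" (infix "\<approx>" 50) where
  beta: "App (Lam A b) a \<approx> inst b a"
| split_pair: "Split C d (Pair a b) \<approx> App (App d a) b"
| case_inl: "Case C l r (InL a) \<approx> App l a"
| case_inr: "Case C l r (InR b) \<approx> App r b"
| unit_star: "UnitElim C c Star \<approx> c"
| two_0: "TwoElim C a b Two0 \<approx> a"
| two_1: "TwoElim C a b Two1 \<approx> b"
| nat_zero: "NatElim C z s Zero \<approx> z"
| nat_succ: "NatElim C z s (Succ n) \<approx> App (App s n) (NatElim C z s n)"
| J_refl: "J C d (Refl a) \<approx> d"
| refl: "t \<approx> t"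
| sym: "t \<approx> u \<Longrightarrow> u \<approx> t"
| trans: "t \<approx> u \<Longrightarrow> u \<approx> v \<Longrightarrow> t \<approx> v"
| cong_Pi: "A \<approx> A' \<Longrightarrow> B \<approx> B' \<Longrightarrow> Pi A B \<approx> Pi A' B'"
| cong_Lam: "A \<approx> A' \<Longrightarrow> b \<approx> b' \<Longrightarrow> Lam A b \<approx> Lam A' b'"
| cong_App: "f \<approx> f' \<Longrightarrow> a \<approx> a' \<Longrightarrow> App f a \<approx> App f' a'"
| cong_Sig: "A \<approx> A' \<Longrightarrow> B \<approx> B' \<Longrightarrow> Sig A B \<approx> Sig A' B'"
| cong_Pair: "a \<approx> a' \<Longrightarrow> b \<approx> b' \<Longrightarrow> Pair a b \<approx> Pair a' b'"
| cong_Split: "C \<approx> C' \<Longrightarrow> d \<approx> d' \<Longrightarrow> p \<approx> p' \<Longrightarrow> Split C d p \<approx> Split C' d' p'"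
| cong_Sum: "A \<approx> A' \<Longrightarrow> B \<approx> B' \<Longrightarrow> Sum A B \<approx> Sum A' B'"
| cong_InL: "a \<approx> a' \<Longrightarrow> InL a \<approx> InL a'"
| cong_InR: "b \<approx> b' \<Longrightarrow> InR b \<approx> InR b'"
| cong_Case: "C \<approx> C' \<Longrightarrow> l \<approx> l' \<Longrightarrow> r \<approx> r' \<Longrightarrow> t \<approx> t' \<Longrightarrow> Case C l r t \<approx> Case C' l' r' t'"
| cong_Absurd: "C \<approx> C' \<Longrightarrow> t \<approx> t' \<Longrightarrow> Absurd C t \<approx> Absurd C' t'"
| cong_UnitElim: "C \<approx> C' \<Longrightarrow> c \<approx> c' \<Longrightarrow> t \<approx> t' \<Longrightarrow> UnitElim C c t \<approx> UnitElim C' c' t'"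
| cong_TwoElim:
    "C \<approx> C' \<Longrightarrow> a \<approx> a' \<Longrightarrow> b \<approx> b' \<Longrightarrow> t \<approx> t' \<Longrightarrow> TwoElim C a b t \<approx> TwoElim C' a' b' t'"
| cong_Succ: "n \<approx> n' \<Longrightarrow> Succ n \<approx> Succ n'"
| cong_NatElim:
    "C \<approx> C' \<Longrightarrow> z \<approx> z' \<Longrightarrow> s \<approx> s' \<Longrightarrow> n \<approx> n' \<Longrightarrow> NatElim C z s n \<approx> NatElim C' z' s' n'"
| cong_Eq: "A \<approx> A' \<Longrightarrow> a \<approx> a' \<Longrightarrow> b \<approx> b' \<Longrightarrow> Eq A a b \<approx> Eq A' a' b'"
| cong_Refl: "a \<approx> a' \<Longrightarrow> Refl a \<approx> Refl a'"
| cong_J: "C \<approx> C' \<Longrightarrow> d \<approx> d' \<Longrightarrow> p \<approx> p' \<Longrightarrow> J C d p \<approx> J C' d' p'"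
| cong_Trunc: "A \<approx> A' \<Longrightarrow> Trunc A \<approx> Trunc A'"
| cong_TruncIn: "a \<approx> a' \<Longrightarrow> TruncIn a \<approx> TruncIn a'"
| cong_TruncProp: "A \<approx> A' \<Longrightarrow> TruncProp A \<approx> TruncProp A'"
| cong_TruncElim:
    "h \<approx> h' \<Longrightarrow> f \<approx> f' \<Longrightarrow> t \<approx> t' \<Longrightarrow> TruncElim h f t \<approx> TruncElim h' f' t'"
| cong_FunExt: "h \<approx> h' \<Longrightarrow> FunExt h \<approx> FunExt h'"
| cong_PropExt:
    "p \<approx> p' \<Longrightarrow> q \<approx> q' \<Longrightarrow> f \<approx> f' \<Longrightarrow> g \<approx> g' \<Longrightarrow> PropExt p q f g \<approx> PropExt p' q' f' g'"


section \<open>Typing\<close>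

text \<open>
  A context lists the types of its variables, innermost first. Types need not belong to the
  universe: \<open>Univ\<close> itself and everything built from it are types without being elements of
  \<open>Univ\<close>. All eliminators may eliminate into such large types.
\<close>

inductive
  ctx :: "tm list \<Rightarrow> bool" and
  is_type :: "tm list \<Rightarrow> tm \<Rightarrow> bool" ("_ \<turnstile> _ type" [51, 51] 50) and
  has_type :: "tm list \<Rightarrow> tm \<Rightarrow> tm \<Rightarrow> bool" ("_ \<turnstile> _ : _" [51, 51, 51] 50)
where
  ctx_Nil: "ctx []"
| ctx_Cons: "\<Gamma> \<turnstile> A type \<Longrightarrow> ctx (A # \<Gamma>)"

| type_Univ: "ctx \<Gamma> \<Longrightarrow> \<Gamma> \<turnstile> Univ type"
| type_El: "\<Gamma> \<turnstile> A : Univ \<Longrightarrow> \<Gamma> \<turnstile> A type"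
| type_Pi: "\<Gamma> \<turnstile> A type \<Longrightarrow> A # \<Gamma> \<turnstile> B type \<Longrightarrow> \<Gamma> \<turnstile> Pi A B type"
| type_Sig: "\<Gamma> \<turnstile> A type \<Longrightarrow> A # \<Gamma> \<turnstile> B type \<Longrightarrow> \<Gamma> \<turnstile> Sig A B type"
| type_Sum: "\<Gamma> \<turnstile> A type \<Longrightarrow> \<Gamma> \<turnstile> B type \<Longrightarrow> \<Gamma> \<turnstile> Sum A B type"
| type_Eq: "\<Gamma> \<turnstile> A type \<Longrightarrow> \<Gamma> \<turnstile> a : A \<Longrightarrow> \<Gamma> \<turnstile> b : A \<Longrightarrow> \<Gamma> \<turnstile> Eq A a b type"
| type_Trunc: "\<Gamma> \<turnstile> A type \<Longrightarrow> \<Gamma> \<turnstile> Trunc A type"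

| conversion: "\<Gamma> \<turnstile> t : A \<Longrightarrow> \<Gamma> \<turnstile> B type \<Longrightarrow> A \<approx> B \<Longrightarrow> \<Gamma> \<turnstile> t : B"
| var: "ctx \<Gamma> \<Longrightarrow> i < length \<Gamma> \<Longrightarrow> \<Gamma> \<turnstile> Var i : (lift 0 ^^ Suc i) (\<Gamma> ! i)"

| univ_Pi: "\<Gamma> \<turnstile> A : Univ \<Longrightarrow> A # \<Gamma> \<turnstile> B : Univ \<Longrightarrow> \<Gamma> \<turnstile> Pi A B : Univ"
| univ_Sig: "\<Gamma> \<turnstile> A : Univ \<Longrightarrow> A # \<Gamma> \<turnstile> B : Univ \<Longrightarrow> \<Gamma> \<turnstile> Sig A B : Univ"
| univ_Sum: "\<Gamma> \<turnstile> A : Univ \<Longrightarrow> \<Gamma> \<turnstile> B : Univ \<Longrightarrow> \<Gamma> \<turnstile> Sum A B : Univ"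
| univ_Eq: "\<Gamma> \<turnstile> A : Univ \<Longrightarrow> \<Gamma> \<turnstile> a : A \<Longrightarrow> \<Gamma> \<turnstile> b : A \<Longrightarrow> \<Gamma> \<turnstile> Eq A a b : Univ"
| univ_Trunc: "\<Gamma> \<turnstile> A : Univ \<Longrightarrow> \<Gamma> \<turnstile> Trunc A : Univ"
| univ_Empty: "ctx \<Gamma> \<Longrightarrow> \<Gamma> \<turnstile> Empty : Univ"
| univ_Unit: "ctx \<Gamma> \<Longrightarrow> \<Gamma> \<turnstile> Unit : Univ"
| univ_Two: "ctx \<Gamma> \<Longrightarrow> \<Gamma> \<turnstile> Two : Univ"
| univ_Nat: "ctx \<Gamma> \<Longrightarrow> \<Gamma> \<turnstile> Nat : Univ"

| Pi_intro: "\<Gamma> \<turnstile> A type \<Longrightarrow> A # \<Gamma> \<turnstile> b : B \<Longrightarrow> \<Gamma> \<turnstile> Lam A b : Pi A B"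
| Pi_elim: "\<Gamma> \<turnstile> f : Pi A B \<Longrightarrow> \<Gamma> \<turnstile> a : A \<Longrightarrow> \<Gamma> \<turnstile> App f a : inst B a"

| Sig_intro: "A # \<Gamma> \<turnstile> B type \<Longrightarrow> \<Gamma> \<turnstile> a : A \<Longrightarrow> \<Gamma> \<turnstile> b : inst B a \<Longrightarrow> \<Gamma> \<turnstile> Pair a b : Sig A B"
| Sig_elim: "Sig A B # \<Gamma> \<turnstile> C type \<Longrightarrow>
    \<Gamma> \<turnstile> d : Pi A (Pi B (inst_under2 C (Pair (Var 1) (Var 0)))) \<Longrightarrow>
    \<Gamma> \<turnstile> p : Sig A B \<Longrightarrow> \<Gamma> \<turnstile> Split C d p : inst C p"

| Sum_introL: "\<Gamma> \<turnstile> B type \<Longrightarrow> \<Gamma> \<turnstile> a : A \<Longrightarrow> \<Gamma> \<turnstile> InL a : Sum A B"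
| Sum_introR: "\<Gamma> \<turnstile> A type \<Longrightarrow> \<Gamma> \<turnstile> b : B \<Longrightarrow> \<Gamma> \<turnstile> InR b : Sum A B"
| Sum_elim: "Sum A B # \<Gamma> \<turnstile> C type \<Longrightarrow>
    \<Gamma> \<turnstile> l : Pi A (inst_under1 C (InL (Var 0))) \<Longrightarrow>
    \<Gamma> \<turnstile> r : Pi B (inst_under1 C (InR (Var 0))) \<Longrightarrow>
    \<Gamma> \<turnstile> t : Sum A B \<Longrightarrow> \<Gamma> \<turnstile> Case C l r t : inst C t"

| Empty_elim: "\<Gamma> \<turnstile> C type \<Longrightarrow> \<Gamma> \<turnstile> t : Empty \<Longrightarrow> \<Gamma> \<turnstile> Absurd C t : C"

| Unit_intro: "ctx \<Gamma> \<Longrightarrow> \<Gamma> \<turnstile> Star : Unit"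
| Unit_elim: "Unit # \<Gamma> \<turnstile> C type \<Longrightarrow> \<Gamma> \<turnstile> c : inst C Star \<Longrightarrow> \<Gamma> \<turnstile> t : Unit \<Longrightarrow>
    \<Gamma> \<turnstile> UnitElim C c t : inst C t"

| Two_intro0: "ctx \<Gamma> \<Longrightarrow> \<Gamma> \<turnstile> Two0 : Two"
| Two_intro1: "ctx \<Gamma> \<Longrightarrow> \<Gamma> \<turnstile> Two1 : Two"
| Two_elim: "Two # \<Gamma> \<turnstile> C type \<Longrightarrow> \<Gamma> \<turnstile> a : inst C Two0 \<Longrightarrow> \<Gamma> \<turnstile> b : inst C Two1 \<Longrightarrow>
    \<Gamma> \<turnstile> t : Two \<Longrightarrow> \<Gamma> \<turnstile> TwoElim C a b t : inst C t"

| Nat_intro0: "ctx \<Gamma> \<Longrightarrow> \<Gamma> \<turnstile> Zero : Nat"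
| Nat_introS: "\<Gamma> \<turnstile> n : Nat \<Longrightarrow> \<Gamma> \<turnstile> Succ n : Nat"
| Nat_elim: "Nat # \<Gamma> \<turnstile> C type \<Longrightarrow> \<Gamma> \<turnstile> z : inst C Zero \<Longrightarrow>
    \<Gamma> \<turnstile> s : Pi Nat (Pi C (inst_under2 C (Succ (Var 1)))) \<Longrightarrow>
    \<Gamma> \<turnstile> n : Nat \<Longrightarrow> \<Gamma> \<turnstile> NatElim C z s n : inst C n"

| Eq_intro: "\<Gamma> \<turnstile> a : A \<Longrightarrow> \<Gamma> \<turnstile> Refl a : Eq A a a"
| Eq_elim: "Eq (lift 0 A) (lift 0 a) (Var 0) # A # \<Gamma> \<turnstile> C type \<Longrightarrow>
    \<Gamma> \<turnstile> d : inst2 C a (Refl a) \<Longrightarrow> \<Gamma> \<turnstile> p : Eq A a b \<Longrightarrow> \<Gamma> \<turnstile> J C d p : inst2 C b p"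

| Trunc_intro: "\<Gamma> \<turnstile> a : A \<Longrightarrow> \<Gamma> \<turnstile> TruncIn a : Trunc A"
| Trunc_prop: "\<Gamma> \<turnstile> A type \<Longrightarrow> \<Gamma> \<turnstile> TruncProp A : IsProp (Trunc A)"
| Trunc_elim: "\<Gamma> \<turnstile> B type \<Longrightarrow> \<Gamma> \<turnstile> h : IsProp B \<Longrightarrow> \<Gamma> \<turnstile> f : Arr A B \<Longrightarrow> \<Gamma> \<turnstile> t : Trunc A \<Longrightarrow>
    \<Gamma> \<turnstile> TruncElim h f t : B"

| funext: "\<Gamma> \<turnstile> f : Pi A B \<Longrightarrow> \<Gamma> \<turnstile> g : Pi A B \<Longrightarrow>
    \<Gamma> \<turnstile> h : Pi A (Eq B (App (lift 0 f) (Var 0)) (App (lift 0 g) (Var 0))) \<Longrightarrow>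
    \<Gamma> \<turnstile> FunExt h : Eq (Pi A B) f g"
| propext: "\<Gamma> \<turnstile> P : Univ \<Longrightarrow> \<Gamma> \<turnstile> Q : Univ \<Longrightarrow> \<Gamma> \<turnstile> p : IsProp P \<Longrightarrow> \<Gamma> \<turnstile> q : IsProp Q \<Longrightarrow>
    \<Gamma> \<turnstile> f : Arr P Q \<Longrightarrow> \<Gamma> \<turnstile> g : Arr Q P \<Longrightarrow> \<Gamma> \<turnstile> PropExt p q f g : Eq Univ P Q"


section \<open>Named binders\<close>

text \<open>
  To write terms with named variables, an \<^emph>\<open>open term\<close> is represented by the function that sends
  the length \<open>n\<close> of the ambient context to the term with de Bruijn indices relative to that
  context. The variable at de Bruijn level \<open>l\<close> (counted from the outermost) has index
  \<open>n - 1 - l\<close> there; passing it to a HOL function yields binding by HOL abstraction,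
  and weakening is implicit. A closed term \<open>t\<close> is read off as \<open>t 0\<close>.
\<close>

type_synonym otm = "nat \<Rightarrow> tm"

definition bv :: "nat \<Rightarrow> otm" where "bv l = (\<lambda>n. Var (n - Suc l))"

definition univ :: otm where "univ = (\<lambda>n. Univ)"

definition pi :: "otm \<Rightarrow> (otm \<Rightarrow> otm) \<Rightarrow> otm" where
  "pi A B = (\<lambda>n. Pi (A n) (B (bv n) (Suc n)))"
definition lam :: "otm \<Rightarrow> (otm \<Rightarrow> otm) \<Rightarrow> otm" where
  "lam A b = (\<lambda>n. Lam (A n) (b (bv n) (Suc n)))"
definition app :: "otm \<Rightarrow> otm \<Rightarrow> otm" (infixl "\<cdot>" 90) where
  "f \<cdot> a = (\<lambda>n. App (f n) (a n))"

definition sig :: "otm \<Rightarrow> (otm \<Rightarrow> otm) \<Rightarrow> otm" where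
  "sig A B = (\<lambda>n. Sig (A n) (B (bv n) (Suc n)))"
definition pair :: "otm \<Rightarrow> otm \<Rightarrow> otm" where
  "pair a b = (\<lambda>n. Pair (a n) (b n))"
definition sig_elim :: "(otm \<Rightarrow> otm) \<Rightarrow> otm \<Rightarrow> otm \<Rightarrow> otm" where
  "sig_elim C d p = (\<lambda>n. Split (C (bv n) (Suc n)) (d n) (p n))"

definition sum_type :: "otm \<Rightarrow> otm \<Rightarrow> otm" (infixr "\<oplus>" 65) where
  "A \<oplus> B = (\<lambda>n. Sum (A n) (B n))"
definition inl :: "otm \<Rightarrow> otm" where "inl a = (\<lambda>n. InL (a n))"
definition inr :: "otm \<Rightarrow> otm" where "inr b = (\<lambda>n. InR (b n))"
definition sum_elim :: "(otm \<Rightarrow> otm) \<Rightarrow> otm \<Rightarrow> otm \<Rightarrow> otm \<Rightarrow> otm" where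
  "sum_elim C l r t = (\<lambda>n. Case (C (bv n) (Suc n)) (l n) (r n) (t n))"

definition empty :: otm where "empty = (\<lambda>n. Empty)"
definition absurd :: "otm \<Rightarrow> otm \<Rightarrow> otm" where
  "absurd C t = (\<lambda>n. Absurd (C n) (t n))"

definition unit :: otm where "unit = (\<lambda>n. Unit)"
definition star :: otm where "star = (\<lambda>n. Star)"
definition unit_elim :: "(otm \<Rightarrow> otm) \<Rightarrow> otm \<Rightarrow> otm \<Rightarrow> otm" where
  "unit_elim C c t = (\<lambda>n. UnitElim (C (bv n) (Suc n)) (c n) (t n))"

definition two :: otm where "two = (\<lambda>n. Two)"
definition two0 :: otm where "two0 = (\<lambda>n. Two0)"
definition two1 :: otm where "two1 = (\<lambda>n. Two1)"
definition two_elim :: "(otm \<Rightarrow> otm) \<Rightarrow> otm \<Rightarrow> otm \<Rightarrow> otm \<Rightarrow> otm" where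
  "two_elim C a b t = (\<lambda>n. TwoElim (C (bv n) (Suc n)) (a n) (b n) (t n))"

definition nat_type :: otm where "nat_type = (\<lambda>n. Nat)"
definition zero :: otm where "zero = (\<lambda>n. Zero)"
definition succ :: "otm \<Rightarrow> otm" where "succ t = (\<lambda>n. Succ (t n))"
definition nat_elim :: "(otm \<Rightarrow> otm) \<Rightarrow> otm \<Rightarrow> otm \<Rightarrow> otm \<Rightarrow> otm" where
  "nat_elim C z s t = (\<lambda>n. NatElim (C (bv n) (Suc n)) (z n) (s n) (t n))"

definition eq :: "otm \<Rightarrow> otm \<Rightarrow> otm \<Rightarrow> otm" where
  "eq A a b = (\<lambda>n. Eq (A n) (a n) (b n))"
definition rfl :: "otm \<Rightarrow> otm" where "rfl a = (\<lambda>n. Refl (a n))"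
definition eq_elim :: "(otm \<Rightarrow> otm \<Rightarrow> otm) \<Rightarrow> otm \<Rightarrow> otm \<Rightarrow> otm" where
  "eq_elim C d p = (\<lambda>n. J (C (bv n) (bv (Suc n)) (Suc (Suc n))) (d n) (p n))"

definition trunc :: "otm \<Rightarrow> otm" where "trunc A = (\<lambda>n. Trunc (A n))"
definition trunc_prop :: "otm \<Rightarrow> otm" where "trunc_prop A = (\<lambda>n. TruncProp (A n))"
definition trunc_elim :: "otm \<Rightarrow> otm \<Rightarrow> otm \<Rightarrow> otm" where
  "trunc_elim h f t = (\<lambda>n. TruncElim (h n) (f n) (t n))"


section \<open>Basic notions\<close>

definition arr :: "otm \<Rightarrow> otm \<Rightarrow> otm" (infixr "\<rightarrow>" 60) where
  "A \<rightarrow> B = pi A (\<lambda>_. B)"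

definition prod_type :: "otm \<Rightarrow> otm \<Rightarrow> otm" (infixr "\<otimes>" 70) where
  "A \<otimes> B = sig A (\<lambda>_. B)"

definition proj1 :: "otm \<Rightarrow> (otm \<Rightarrow> otm) \<Rightarrow> otm \<Rightarrow> otm" where
  "proj1 A B p = sig_elim (\<lambda>_. A) (lam A (\<lambda>a. lam (B a) (\<lambda>b. a))) p"

definition proj2 :: "otm \<Rightarrow> (otm \<Rightarrow> otm) \<Rightarrow> otm \<Rightarrow> otm" where
  "proj2 A B p = sig_elim (\<lambda>q. B (proj1 A B q)) (lam A (\<lambda>a. lam (B a) (\<lambda>b. b))) p"

definition is_prop :: "otm \<Rightarrow> otm" where
  "is_prop A = pi A (\<lambda>x. pi A (\<lambda>y. eq A x y))"

definition is_equiv :: "otm \<Rightarrow> otm \<Rightarrow> otm \<Rightarrow> otm" where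
  "is_equiv A B f =
     sig (B \<rightarrow> A) (\<lambda>g. pi B (\<lambda>y. eq B (f \<cdot> (g \<cdot> y)) y)) \<otimes>
     sig (B \<rightarrow> A) (\<lambda>h. pi A (\<lambda>x. eq A (h \<cdot> (f \<cdot> x)) x))"

definition equiv_type :: "otm \<Rightarrow> otm \<Rightarrow> otm" (infix "\<simeq>" 55) where
  "A \<simeq> B = sig (A \<rightarrow> B) (\<lambda>f. is_equiv A B f)"

text \<open>\<open>transport F d p : F b\<close> for \<open>d : F a\<close> and \<open>p : a = b\<close>.\<close>

definition transport :: "(otm \<Rightarrow> otm) \<Rightarrow> otm \<Rightarrow> otm \<Rightarrow> otm" where
  "transport F d p = eq_elim (\<lambda>x _. F x) d p"


section \<open>Primitive recursive functions\<close>

text \<open>\<open>fin n\<close> is the standard type with \<open>n\<close> elements; \<open>n\<close>-tuples are functions on it.\<close>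

definition fin :: "otm \<Rightarrow> otm" where
  "fin n = nat_elim (\<lambda>_. univ) empty (lam nat_type (\<lambda>_. lam univ (\<lambda>F. unit \<oplus> F))) n"

definition tuple :: "otm \<Rightarrow> otm" where
  "tuple n = fin n \<rightarrow> nat_type"

definition tuple_hd :: "otm \<Rightarrow> otm" where
  "tuple_hd v = v \<cdot> inl star"

definition tuple_tl :: "otm \<Rightarrow> otm \<Rightarrow> otm" where
  "tuple_tl n v = lam (fin n) (\<lambda>i. v \<cdot> inr i)"

definition tuple_cons :: "otm \<Rightarrow> otm \<Rightarrow> otm \<Rightarrow> otm" where
  "tuple_cons n a v =
     lam (fin (succ n)) (sum_elim (\<lambda>_. nat_type) (lam unit (\<lambda>_. a)) (lam (fin n) (\<lambda>j. v \<cdot> j)))"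

text \<open>
  The primitive recursive functions form the smallest class of functions of all arities that
  contains the zero functions, the successor and the projections and is closed under
  composition and primitive recursion, where
  \<open>f(0, w) = g(w)\<close> and \<open>f(k + 1, w) = h(k, f(k, w), w)\<close>. As the classes range over all
  universe-valued families, \<open>is_primrec f\<close> is a large type; nothing below needs it to be small.
\<close>

definition primrec_closed :: "otm \<Rightarrow> otm" where
  "primrec_closed X =
     pi nat_type (\<lambda>n. X \<cdot> n \<cdot> lam (tuple n) (\<lambda>v. zero)) \<otimes>
     X \<cdot> succ zero \<cdot> lam (tuple (succ zero)) (\<lambda>v. succ (tuple_hd v)) \<otimes>
     pi nat_type (\<lambda>n. pi (fin n) (\<lambda>i. X \<cdot> n \<cdot> lam (tuple n) (\<lambda>v. v \<cdot> i))) \<otimes>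
     pi nat_type (\<lambda>m. pi nat_type (\<lambda>n.
       pi (tuple m \<rightarrow> nat_type) (\<lambda>g. pi (fin m \<rightarrow> tuple n \<rightarrow> nat_type) (\<lambda>h.
         X \<cdot> m \<cdot> g \<rightarrow> pi (fin m) (\<lambda>i. X \<cdot> n \<cdot> (h \<cdot> i)) \<rightarrow>
         X \<cdot> n \<cdot> lam (tuple n) (\<lambda>v. g \<cdot> lam (fin m) (\<lambda>i. h \<cdot> i \<cdot> v)))))) \<otimes>
     pi nat_type (\<lambda>n.
       pi (tuple n \<rightarrow> nat_type) (\<lambda>g. pi (tuple (succ (succ n)) \<rightarrow> nat_type) (\<lambda>h.
         X \<cdot> n \<cdot> g \<rightarrow> X \<cdot> succ (succ n) \<cdot> h \<rightarrow>
         X \<cdot> succ n \<cdot> lam (tuple (succ n)) (\<lambda>v.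
           nat_elim (\<lambda>_. nat_type) (g \<cdot> tuple_tl n v)
             (lam nat_type (\<lambda>k. lam nat_type (\<lambda>r.
                h \<cdot> tuple_cons (succ n) k (tuple_cons n r (tuple_tl n v)))))
             (tuple_hd v)))))"

definition is_primrec :: "otm \<Rightarrow> otm" where
  "is_primrec f =
     pi (pi nat_type (\<lambda>n. (tuple n \<rightarrow> nat_type) \<rightarrow> univ)) (\<lambda>X.
       primrec_closed X \<rightarrow>
       X \<cdot> succ zero \<cdot> lam (tuple (succ zero)) (\<lambda>v. f \<cdot> tuple_hd v))"

definition primrec_type :: otm where
  "primrec_type = sig (nat_type \<rightarrow> nat_type) is_primrec"

definition primrec_fun :: "otm \<Rightarrow> otm" where
  "primrec_fun p = proj1 (nat_type \<rightarrow> nat_type) is_primrec p"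


section \<open>Recursive machines\<close>

definition machine :: otm where
  "machine = primrec_type \<otimes> primrec_type"

definition machine_init :: "otm \<Rightarrow> otm" where
  "machine_init m = primrec_fun (proj1 primrec_type (\<lambda>_. primrec_type) m)"

definition machine_step :: "otm \<Rightarrow> otm" where
  "machine_step m = primrec_fun (proj2 primrec_type (\<lambda>_. primrec_type) m)"

definition state :: otm where
  "state = nat_type \<oplus> nat_type"

text \<open>The bijection with \<open>2n \<mapsto> inl n\<close> and \<open>2n + 1 \<mapsto> inr n\<close>.\<close>

definition decode :: "otm \<Rightarrow> otm" where
  "decode t = nat_elim (\<lambda>_. state) (inl zero)
     (lam nat_type (\<lambda>_. lam state (\<lambda>z.
        sum_elim (\<lambda>_. state) (lam nat_type (\<lambda>a. inr a)) (lam nat_type (\<lambda>a. inl (succ a))) z))) t"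

text \<open>Below, \<open>i\<close> and \<open>s\<close> are the functions underlying the two components of a machine.\<close>

definition step :: "otm \<Rightarrow> otm \<Rightarrow> otm" where
  "step s z = sum_elim (\<lambda>_. state)
     (lam nat_type (\<lambda>x. decode (s \<cdot> x))) (lam nat_type (\<lambda>y. inr y)) z"

definition run :: "otm \<Rightarrow> otm \<Rightarrow> otm \<Rightarrow> otm \<Rightarrow> otm" where
  "run i s x k = nat_elim (\<lambda>_. state) (inl (i \<cdot> x))
     (lam nat_type (\<lambda>_. lam state (\<lambda>z. step s z))) k"

definition halts_with :: "otm \<Rightarrow> otm \<Rightarrow> otm \<Rightarrow> otm \<Rightarrow> otm" where
  "halts_with i s x y = sig nat_type (\<lambda>k. eq state (run i s x k) (inr y))"

definition extent :: "otm \<Rightarrow> otm \<Rightarrow> otm \<Rightarrow> otm" where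
  "extent i s x = sig nat_type (\<lambda>y. trunc (halts_with i s x y))"


section \<open>The extent of a computation is a proposition\<close>

text \<open>An element of the lifting contains such a proof, so a concrete one is needed below.\<close>

definition add :: "otm \<Rightarrow> otm \<Rightarrow> otm" where
  "add j k = nat_elim (\<lambda>_. nat_type) k (lam nat_type (\<lambda>_. lam nat_type (\<lambda>r. succ r))) j"

text \<open>\<open>succ_cong a p : succ a = succ b\<close> for \<open>p : a = b\<close>.\<close>

definition succ_cong :: "otm \<Rightarrow> otm \<Rightarrow> otm" where
  "succ_cong a p = transport (\<lambda>x. eq nat_type (succ a) (succ x)) (rfl (succ a)) p"

text \<open>\<open>add_zero k : k = add k zero\<close>\<close>

definition add_zero :: "otm \<Rightarrow> otm" where
  "add_zero k = nat_elim (\<lambda>k. eq nat_type k (add k zero)) (rfl zero)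
     (lam nat_type (\<lambda>k. lam (eq nat_type k (add k zero)) (\<lambda>ih. succ_cong k ih))) k"

text \<open>\<open>add_succ k j : succ (add k j) = add k (succ j)\<close>\<close>

definition add_succ :: "otm \<Rightarrow> otm \<Rightarrow> otm" where
  "add_succ k j = nat_elim (\<lambda>k. eq nat_type (succ (add k j)) (add k (succ j))) (rfl (succ j))
     (lam nat_type (\<lambda>k. lam (eq nat_type (succ (add k j)) (add k (succ j))) (\<lambda>ih.
        succ_cong (succ (add k j)) ih))) k"

text \<open>\<open>add_comm j k : add j k = add k j\<close>\<close>

definition add_comm :: "otm \<Rightarrow> otm \<Rightarrow> otm" where
  "add_comm j k = nat_elim (\<lambda>j. eq nat_type (add j k) (add k j)) (add_zero k)
     (lam nat_type (\<lambda>j. lam (eq nat_type (add j k) (add k j)) (\<lambda>ih.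
        transport (\<lambda>w. eq nat_type (succ (add j k)) w) (succ_cong (add j k) ih) (add_succ k j)))) j"

text \<open>Observational equality of natural numbers, used because it is evidently a proposition.\<close>

definition obs :: "otm \<Rightarrow> otm \<Rightarrow> otm" where
  "obs m n = nat_elim (\<lambda>_. nat_type \<rightarrow> univ)
     (lam nat_type (\<lambda>n.
        nat_elim (\<lambda>_. univ) unit (lam nat_type (\<lambda>_. lam univ (\<lambda>_. empty))) n))
     (lam nat_type (\<lambda>_. lam (nat_type \<rightarrow> univ) (\<lambda>E. lam nat_type (\<lambda>n.
        nat_elim (\<lambda>_. univ) empty (lam nat_type (\<lambda>n'. lam univ (\<lambda>_. E \<cdot> n'))) n)))) m \<cdot> n"

definition obs_refl :: "otm \<Rightarrow> otm" where
  "obs_refl n = nat_elim (\<lambda>n. obs n n) star (lam nat_type (\<lambda>n. lam (obs n n) (\<lambda>ih. ih))) n"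

text \<open>\<open>obs_induct G z s0 s1 ss m n : G m n\<close>, by double induction.\<close>

definition obs_induct ::
  "(otm \<Rightarrow> otm \<Rightarrow> otm) \<Rightarrow> otm \<Rightarrow> (otm \<Rightarrow> otm) \<Rightarrow> (otm \<Rightarrow> otm) \<Rightarrow> (otm \<Rightarrow> otm \<Rightarrow> otm \<Rightarrow> otm) \<Rightarrow>
   otm \<Rightarrow> otm \<Rightarrow> otm" where
  "obs_induct G z s0 s1 ss m n = nat_elim (\<lambda>m. pi nat_type (\<lambda>n. G m n))
     (lam nat_type (\<lambda>n. nat_elim (\<lambda>n. G zero n) z
        (lam nat_type (\<lambda>n. lam (G zero n) (\<lambda>_. s0 n))) n))
     (lam nat_type (\<lambda>m. lam (pi nat_type (\<lambda>n. G m n)) (\<lambda>ih. lam nat_type (\<lambda>n.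
        nat_elim (\<lambda>n. G (succ m) n) (s1 m)
          (lam nat_type (\<lambda>n. lam (G (succ m) n) (\<lambda>_. ss m n (ih \<cdot> n)))) n)))) m \<cdot> n"

definition unit_is_prop :: otm where
  "unit_is_prop = lam unit (\<lambda>x. lam unit (\<lambda>y.
     unit_elim (\<lambda>x. eq unit x y) (unit_elim (\<lambda>y. eq unit star y) (rfl star) y) x))"

definition empty_is_prop :: otm where
  "empty_is_prop = lam empty (\<lambda>x. lam empty (\<lambda>y. absurd (eq empty x y) x))"

definition obs_is_prop :: "otm \<Rightarrow> otm \<Rightarrow> otm" where
  "obs_is_prop m n = obs_induct (\<lambda>m n. is_prop (obs m n))
     unit_is_prop (\<lambda>_. empty_is_prop) (\<lambda>_. empty_is_prop) (\<lambda>_ _ ih. ih) m n"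

definition obs_to_eq :: "otm \<Rightarrow> otm \<Rightarrow> otm \<Rightarrow> otm" where
  "obs_to_eq m n e = obs_induct (\<lambda>m n. obs m n \<rightarrow> eq nat_type m n)
     (lam unit (\<lambda>_. rfl zero))
     (\<lambda>n. lam empty (\<lambda>e. absurd (eq nat_type zero (succ n)) e))
     (\<lambda>m. lam empty (\<lambda>e. absurd (eq nat_type (succ m) zero) e))
     (\<lambda>m n ih. lam (obs m n) (\<lambda>e. succ_cong m (ih \<cdot> e))) m n \<cdot> e"

text \<open>\<open>run_stays i s x k y p j : run i s x (add j k) = inr y\<close> for \<open>p : run i s x k = inr y\<close>.\<close>

definition run_stays :: "otm \<Rightarrow> otm \<Rightarrow> otm \<Rightarrow> otm \<Rightarrow> otm \<Rightarrow> otm \<Rightarrow> otm \<Rightarrow> otm" where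
  "run_stays i s x k y p j = nat_elim (\<lambda>j. eq state (run i s x (add j k)) (inr y)) p
     (lam nat_type (\<lambda>j. lam (eq state (run i s x (add j k)) (inr y)) (\<lambda>ih.
        transport (\<lambda>z. eq state (step s (run i s x (add j k))) (step s z))
          (rfl (step s (run i s x (add j k)))) ih))) j"

text \<open>\<open>run_agree i s x k y p k' y' p' : obs y y'\<close> for \<open>p : run i s x k = inr y\<close>
  and \<open>p' : run i s x k' = inr y'\<close>.\<close>

definition run_agree ::
  "otm \<Rightarrow> otm \<Rightarrow> otm \<Rightarrow> otm \<Rightarrow> otm \<Rightarrow> otm \<Rightarrow> otm \<Rightarrow> otm \<Rightarrow> otm \<Rightarrow> otm" where
  "run_agree i s x k y p k' y' p' =
     (let F = (\<lambda>z. sum_elim (\<lambda>_. univ) (lam nat_type (\<lambda>_. empty)) (lam nat_type (\<lambda>n. obs y n)) z);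
          q = run_stays i s x k y p k';
          q' = run_stays i s x k' y' p' k;
          q_sym = transport (\<lambda>z. eq state z (run i s x (add k' k))) (rfl (run i s x (add k' k))) q
      in transport F
           (transport (\<lambda>w. F (run i s x w)) (transport F (obs_refl y) q_sym) (add_comm k' k)) q')"

definition halts_agree :: "otm \<Rightarrow> otm \<Rightarrow> otm \<Rightarrow> otm \<Rightarrow> otm \<Rightarrow> otm \<Rightarrow> otm \<Rightarrow> otm" where
  "halts_agree i s x y u y' u' =
     sig_elim (\<lambda>_. obs y y') (lam nat_type (\<lambda>k. lam (eq state (run i s x k) (inr y)) (\<lambda>p.
       sig_elim (\<lambda>_. obs y y') (lam nat_type (\<lambda>k'. lam (eq state (run i s x k') (inr y')) (\<lambda>p'.
         run_agree i s x k y p k' y' p'))) u'))) u"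

definition value_unique :: "otm \<Rightarrow> otm \<Rightarrow> otm \<Rightarrow> otm \<Rightarrow> otm \<Rightarrow> otm \<Rightarrow> otm \<Rightarrow> otm" where
  "value_unique i s x y t y' t' = obs_to_eq y y'
     (trunc_elim (obs_is_prop y y') (lam (halts_with i s x y) (\<lambda>u.
        trunc_elim (obs_is_prop y y') (lam (halts_with i s x y') (\<lambda>u'.
          halts_agree i s x y u y' u')) t')) t)"

definition extent_is_prop :: otm where
  "extent_is_prop =
     lam (nat_type \<rightarrow> nat_type) (\<lambda>i. lam (nat_type \<rightarrow> nat_type) (\<lambda>s. lam nat_type (\<lambda>x.
       let E = extent i s x; T = (\<lambda>y. trunc (halts_with i s x y))
       in lam E (\<lambda>e. lam E (\<lambda>e'.
            sig_elim (\<lambda>e. eq E e e') (lam nat_type (\<lambda>y. lam (T y) (\<lambda>t.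
              sig_elim (\<lambda>e'. eq E (pair y t) e') (lam nat_type (\<lambda>y'. lam (T y') (\<lambda>t'.
                transport (\<lambda>w. pi (T w) (\<lambda>r. eq E (pair y t) (pair w r)))
                  (lam (T y) (\<lambda>r.
                     transport (\<lambda>r. eq E (pair y t) (pair y r)) (rfl (pair y t))
                       (trunc_prop (halts_with i s x y) \<cdot> t \<cdot> r)))
                  (value_unique i s x y t y' t') \<cdot> t'))) e'))) e)))))"


section \<open>Lifting, computability and Church's thesis\<close>

definition lifting :: "otm \<Rightarrow> otm" where
  "lifting Y = sig univ (\<lambda>P. is_prop P \<otimes> (P \<rightarrow> Y))"

definition eta :: "otm \<Rightarrow> otm" where
  "eta y = pair unit (pair unit_is_prop (lam unit (\<lambda>_. y)))"

definition eval :: "otm \<Rightarrow> otm" where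
  "eval m = lam nat_type (\<lambda>x.
     let i = machine_init m; s = machine_step m
     in pair (extent i s x) (pair (extent_is_prop \<cdot> i \<cdot> s \<cdot> x)
          (lam (extent i s x) (\<lambda>e. proj1 nat_type (\<lambda>y. trunc (halts_with i s x y)) e))))"

definition is_computable :: "otm \<Rightarrow> otm" where
  "is_computable g = trunc (sig machine (\<lambda>m. eq (nat_type \<rightarrow> lifting nat_type) g (eval m)))"

definition is_computable_total :: "otm \<Rightarrow> otm" where
  "is_computable_total g = is_computable (lam nat_type (\<lambda>n. eta (g \<cdot> n)))"

definition church_thesis :: otm where
  "church_thesis = pi (nat_type \<rightarrow> nat_type) is_computable_total"


section \<open>Semidecidability and Rosolini structure\<close>

definition two_to_nat :: "otm \<Rightarrow> otm" where
  "two_to_nat b = two_elim (\<lambda>_. nat_type) zero (succ zero) b"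

definition is_computable_two :: "otm \<Rightarrow> otm" where
  "is_computable_two f = is_computable (lam nat_type (\<lambda>n. eta (two_to_nat (f \<cdot> n))))"

definition angle :: "otm \<Rightarrow> otm" ("\<langle>_\<rangle>") where
  "\<langle>f\<rangle> = sig nat_type (\<lambda>n. eq two (f \<cdot> n) two1)"

definition nat_infty :: otm where
  "nat_infty = sig (nat_type \<rightarrow> two) (\<lambda>f. is_prop \<langle>f\<rangle>)"

definition rosolini_structure :: "otm \<Rightarrow> otm" where
  "rosolini_structure P = sig nat_infty (\<lambda>u.
     eq univ P \<langle>proj1 (nat_type \<rightarrow> two) (\<lambda>f. is_prop \<langle>f\<rangle>) u\<rangle>)"

definition semi_decision :: "otm \<Rightarrow> otm" where
  "semi_decision P = sig (nat_type \<rightarrow> two) (\<lambda>f.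
     is_prop \<langle>f\<rangle> \<otimes> is_computable_two f \<otimes> (P \<simeq> \<langle>f\<rangle>))"

end

theory Submission
  imports Defs
begin

text \<open>
  Given Church's thesis \<open>c\<close>, computability of \<open>f : \<nat> \<rightarrow> 2\<close> is inhabited by \<open>c\<close> at the composite of \<open>f\<close> with
  \<open>2 \<subseteq> \<nat>\<close>, and it is a proposition because it is a truncation. So \<open>semi_decision P\<close> and
  \<open>rosolini_structure P\<close> differ only in that the former has \<open>P \<simeq> \<langle>f\<rangle>\<close> where the latter has
  \<open>P = \<langle>f\<rangle>\<close>. As \<open>\<langle>f\<rangle>\<close> is a proposition, proposition extensionality gives maps in both directions
  between these types, and both are propositions: \<open>P \<simeq> \<langle>f\<rangle>\<close> by function extensionality, and
  \<open>P = \<langle>f\<rangle>\<close> by Hedberg's argument, as equality with a proposition has a constant endomap.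

  The terms witnessing this are written with named binders, and a type checker for the
  embedded theory, proved sound and evaluated by the simplifier, derives their typing judgements.
\<close>

section \<open>Weakening, substitution and validity\<close>

text \<open>Size shapes the argument about propositions. An identity type of the universe, such as
  \<open>P = \<langle>f\<rangle>\<close>, is large, so closure lemmas that quantify over small types
  cannot treat it, and it gets a path induction of its own. There the right endpoint must be free,
  so whatever depends on it (its propositionality and the maps to and from \<open>P\<close>) is
  generalised before the induction. In contrast, \<open>P \<simeq> \<langle>f\<rangle>\<close> is
  small and is handled by those closure lemmas. Definitional equality relates raw terms, and neither
  confluence nor subject reduction is available. Soundness of the checker does not depend on them:
  inversion is applied only to types that literally have the required shape, and a type obtained by
  reduction is checked afresh. Recursion on fuel makes the checker total without any normalisation
  argument.\<close>

lemma lift_lift: "i \<le> k \<Longrightarrow> lift (Suc k) (lift i t) = lift i (lift k t)"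
  by (induction t arbitrary: i k) auto

lemma lift_subst_le: "k \<le> i \<Longrightarrow> lift k (subst i u t) = subst (Suc i) (lift k u) (lift k t)"
  by (induction t arbitrary: i k u) (auto simp: lift_lift)

lemma lift_subst_ge: "i \<le> k \<Longrightarrow> lift k (subst i u t) = subst i (lift k u) (lift (Suc k) t)"
  by (induction t arbitrary: i k u) (auto simp: lift_lift)

lemma subst_lift [simp]: "subst k u (lift k t) = t"
  by (induction t arbitrary: k u) auto

lemma subst_lift_le: "i \<le> k \<Longrightarrow> subst (Suc k) (lift i u) (lift i t) = lift i (subst k u t)"
  by (simp add: lift_subst_le)

lemma subst_subst:
  "i \<le> k \<Longrightarrow> subst k u (subst i v t) = subst i (subst k u v) (subst (Suc k) (lift i u) t)"
  by (induction t arbitrary: i k u v) (auto simp: lift_lift subst_lift_le)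

text \<open>The branch types of the eliminators lift their motive at index 1, inside
  \<open>inst_under1\<close> and \<open>inst_under2\<close>; substituting into them produces this
  instance.\<close>

lemma subst_lift_1:
  "subst (Suc (Suc k)) (lift 0 (lift 0 u)) (lift (Suc 0) t) = lift (Suc 0) (subst (Suc k) (lift 0 u) t)"
  using subst_lift_le[of "Suc 0" "Suc k" "lift 0 u" t] by (simp add: lift_lift)

lemma subst_inst2:
  "subst k u (inst2 C a e) =
     inst2 (subst (Suc (Suc k)) (lift 0 (lift 0 u)) C) (subst k u a) (subst k u e)"
  by (subst subst_subst, simp, subst subst_subst, simp) (simp add: subst_lift_le)

lemma conv_lift: "t \<approx> u \<Longrightarrow> lift k t \<approx> lift k u"
proof (induction arbitrary: k rule: conv.induct)
  case (beta A b a)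
  then show ?case using conv.beta[of "lift k A" "lift (Suc k) b" "lift k a"] by (simp add: lift_subst_ge)
qed (auto intro: conv.intros)

lemma conv_subst: "t \<approx> u \<Longrightarrow> subst k v t \<approx> subst k v u"
proof (induction arbitrary: k v rule: conv.induct)
  case (beta A b a)
  then show ?case
    using conv.beta[of "subst k v A" "subst (Suc k) (lift 0 v) b" "subst k v a"]
    by (simp add: subst_subst)
next
  case (trans t u w)
  then show ?case by (blast intro: conv.trans)
qed (auto intro: conv.intros)

section \<open>Weakening and substitution for the judgements\<close>

lemma judgement_ctx:
  "(ctx \<Gamma> \<longrightarrow> True) \<and> (\<Gamma> \<turnstile> A type \<longrightarrow> ctx \<Gamma>) \<and> (\<Gamma> \<turnstile> t : B \<longrightarrow> ctx \<Gamma>)"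
proof -
  have "(ctx \<Gamma> \<Longrightarrow> True)" "(\<Gamma> \<turnstile> A type \<Longrightarrow> ctx \<Gamma>)" "(\<Gamma> \<turnstile> t : B \<Longrightarrow> ctx \<Gamma>)" for \<Gamma> A t B
    by (induction rule: ctx_is_type_has_type.inducts) auto
  then show ?thesis by blast
qed

lemmas type_ctx = judgement_ctx[THEN conjunct2, THEN conjunct1, rule_format]
lemmas term_ctx = judgement_ctx[THEN conjunct2, THEN conjunct2, rule_format]

text \<open>Inserting the fresh variable below \<open>k\<close> others, and not only at the front,
  lets the induction in \<open>weakening_lift\<close> pass under binders.\<close>

inductive weakening :: "nat \<Rightarrow> tm list \<Rightarrow> tm list \<Rightarrow> bool" where
  weakening_0: "\<Gamma> \<turnstile> A type \<Longrightarrow> weakening 0 \<Gamma> (A # \<Gamma>)"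
| weakening_Suc: "weakening k \<Gamma> \<Gamma>' \<Longrightarrow> weakening (Suc k) (B # \<Gamma>) (lift k B # \<Gamma>')"

lemma weakening_nth:
  assumes "weakening k \<Gamma> \<Gamma>'" "i < length \<Gamma>"
  shows "lift k ((lift 0 ^^ Suc i) (\<Gamma> ! i)) =
           (lift 0 ^^ Suc (if i < k then i else Suc i)) (\<Gamma>' ! (if i < k then i else Suc i))
         \<and> length \<Gamma>' = Suc (length \<Gamma>)"
  using assms
proof (induction arbitrary: i rule: weakening.induct)
  case (weakening_0 \<Gamma> A)
  then show ?case by (simp add: funpow_swap1)
next
  case (weakening_Suc k \<Gamma> \<Gamma>' B)
  show ?case
  proof (cases i)
    case 0
    then show ?thesis using weakening_Suc by (cases \<Gamma>) (auto simp: lift_lift elim: weakening.cases)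
  next
    case (Suc j)
    then show ?thesis using weakening_Suc.IH[of j] weakening_Suc.prems
      by (auto simp: lift_lift)
  qed
qed

lemma lift_IsProp [simp]: "lift k (IsProp A) = IsProp (lift k A)"
  by (simp add: IsProp_def lift_lift)

lemma subst_IsProp [simp]: "subst k u (IsProp A) = IsProp (subst k u A)"
  by (simp add: IsProp_def subst_lift_le)

text \<open>Leaves out \<open>type_El\<close> and \<open>conversion\<close>, which would match any
  goal of their judgement, and \<open>var\<close>, which needs the analysis of context
  entries.\<close>

lemmas typing_rules =
  type_Univ type_Pi type_Sig type_Sum type_Eq type_Trunc
  univ_Pi univ_Sig univ_Sum univ_Eq univ_Trunc univ_Empty univ_Unit univ_Two univ_Nat
  Pi_intro Pi_elim Sig_intro Sig_elim Sum_introL Sum_introR Sum_elim Empty_elim Unit_intro Unit_elim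
  Two_intro0 Two_intro1 Two_elim Nat_intro0 Nat_introS Nat_elim Eq_intro Eq_elim
  Trunc_intro Trunc_prop Trunc_elim funext propext

lemmas typing_rules_Suc = typing_rules[unfolded One_nat_def]

lemma weakening_lift:
  shows "ctx \<Gamma> \<Longrightarrow> weakening k \<Gamma> \<Gamma>' \<Longrightarrow> ctx \<Gamma>'"
    and "\<Gamma> \<turnstile> A type \<Longrightarrow> weakening k \<Gamma> \<Gamma>' \<Longrightarrow> \<Gamma>' \<turnstile> lift k A type"
    and "\<Gamma> \<turnstile> t : A \<Longrightarrow> weakening k \<Gamma> \<Gamma>' \<Longrightarrow> \<Gamma>' \<turnstile> lift k t : lift k A"
proof (induction arbitrary: k \<Gamma>' and k \<Gamma>' and k \<Gamma>' rule: ctx_is_type_has_type.inducts)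
  case ctx_Nil
  then show ?case by (auto elim: weakening.cases intro: ctx_Cons)
next
  case (ctx_Cons \<Gamma> A)
  from ctx_Cons.prems show ?case
    by cases (auto intro: ctx_is_type_has_type.ctx_Cons ctx_Cons.IH)
next
  case (var \<Gamma> i)
  then show ?case
    using weakening_nth[of k \<Gamma> \<Gamma>' i]
      ctx_is_type_has_type.var[of \<Gamma>' "if i < k then i else Suc i"]
    by (auto split: if_splits)
next
  case (conversion \<Gamma> t A B)
  then show ?case by (blast intro: ctx_is_type_has_type.conversion conv_lift)
next
  case (type_El \<Gamma> A)
  then show ?case by (auto intro: ctx_is_type_has_type.type_El)


next
  case (Eq_elim A a \<Gamma> C d p b)
  \<comment> \<open>The motive of \<open>J\<close> lies under two variables, and the type of the
    second mentions lifted terms. The lifts must be commuted before the context has the form that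
    the rule demands.\<close>
  have "weakening (Suc (Suc k)) (Eq (lift 0 A) (lift 0 a) (Var 0) # A # \<Gamma>)
          (Eq (lift 0 (lift k A)) (lift 0 (lift k a)) (Var 0) # lift k A # \<Gamma>')"
    using weakening_Suc[OF weakening_Suc[OF Eq_elim.prems, of A], of "Eq (lift 0 A) (lift 0 a) (Var 0)"]
    by (simp add: lift_lift)
  from Eq_elim.IH(1)[OF this] Eq_elim.IH(2,3)[OF Eq_elim.prems] show ?case
    by (simp add: lift_subst_ge lift_lift) (erule ctx_is_type_has_type.Eq_elim; simp)
qed (simp add: lift_subst_ge lift_lift, rule typing_rules_Suc; fastforce intro: weakening_Suc)+

inductive substitution :: "nat \<Rightarrow> tm \<Rightarrow> tm list \<Rightarrow> tm list \<Rightarrow> bool" where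
  substitution_0: "\<Gamma> \<turnstile> u : A \<Longrightarrow> substitution 0 u (A # \<Gamma>) \<Gamma>"
| substitution_Suc: "substitution k u \<Gamma> \<Gamma>' \<Longrightarrow>
    substitution (Suc k) (lift 0 u) (B # \<Gamma>) (subst k u B # \<Gamma>')"

lemma substitution_nth:
  assumes "substitution k u \<Gamma> \<Gamma>'" "i < length \<Gamma>" "ctx \<Gamma>'"
  shows "\<Gamma>' \<turnstile> subst k u (Var i) : subst k u ((lift 0 ^^ Suc i) (\<Gamma> ! i))"
  using assms
proof (induction arbitrary: i rule: substitution.induct)
  case (substitution_0 \<Gamma> u A)
  show ?case
  proof (cases i)
    case 0
    then show ?thesis using substitution_0 by simp
  next
    case (Suc j)
    then show ?thesis using substitution_0 var[of \<Gamma> j] by simp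
  qed
next
  case (substitution_Suc k u \<Gamma> \<Gamma>' B)
  from substitution_Suc.prems(2) have B: "\<Gamma>' \<turnstile> subst k u B type" by (auto elim: ctx.cases)
  show ?case
  proof (cases i)
    case 0
    then show ?thesis
      using var[OF substitution_Suc.prems(2), of 0] by (simp add: subst_lift_le)
  next
    case (Suc j)
    with substitution_Suc.IH[of j] substitution_Suc.prems B
    have "\<Gamma>' \<turnstile> subst k u (Var j) : subst k u ((lift 0 ^^ Suc j) (\<Gamma> ! j))"
      by (simp add: type_ctx)
    from weakening_lift(3)[OF this weakening_0[OF B]] Suc show ?thesis
      by (auto simp: subst_lift_le split: if_splits)
  qed
qed

lemma substitution_subst:
  shows "ctx \<Gamma> \<Longrightarrow> substitution k u \<Gamma> \<Gamma>' \<Longrightarrow> ctx \<Gamma>'"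
    and "\<Gamma> \<turnstile> A type \<Longrightarrow> substitution k u \<Gamma> \<Gamma>' \<Longrightarrow> \<Gamma>' \<turnstile> subst k u A type"
    and "\<Gamma> \<turnstile> t : A \<Longrightarrow> substitution k u \<Gamma> \<Gamma>' \<Longrightarrow> \<Gamma>' \<turnstile> subst k u t : subst k u A"
proof (induction arbitrary: k u \<Gamma>' and k u \<Gamma>' and k u \<Gamma>' rule: ctx_is_type_has_type.inducts)
  case ctx_Nil
  then show ?case by (auto elim: substitution.cases)
next
  case (ctx_Cons \<Gamma> A)
  from ctx_Cons.prems show ?case
    by cases (auto intro: ctx_is_type_has_type.ctx_Cons ctx_Cons.IH term_ctx)
next
  case (var \<Gamma> i)
  then show ?case by (blast intro: substitution_nth)
next
  case (conversion \<Gamma> t A B)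
  then show ?case by (blast intro: ctx_is_type_has_type.conversion conv_subst)
next
  case (type_El \<Gamma> A)
  then show ?case by (auto intro: ctx_is_type_has_type.type_El)
next
  case (Eq_elim A a \<Gamma> C d p b)
  have "substitution (Suc (Suc k)) (lift 0 (lift 0 u)) (Eq (lift 0 A) (lift 0 a) (Var 0) # A # \<Gamma>)
          (Eq (lift 0 (subst k u A)) (lift 0 (subst k u a)) (Var 0) # subst k u A # \<Gamma>')"
    using substitution_Suc[OF substitution_Suc[OF Eq_elim.prems, of A], of "Eq (lift 0 A) (lift 0 a) (Var 0)"]
    by (simp add: subst_lift_le)
  from Eq_elim.IH(1)[OF this] Eq_elim.IH(2,3)[OF Eq_elim.prems] show ?case
    unfolding subst_inst2 subst.simps by (rule ctx_is_type_has_type.Eq_elim)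
qed (simp add: subst_subst subst_lift_le subst_lift_1, rule typing_rules_Suc; fastforce intro: substitution_Suc)+


section \<open>Inversion, validity and closed terms\<close>

lemma lift_type: "\<Gamma> \<turnstile> B type \<Longrightarrow> \<Gamma> \<turnstile> A type \<Longrightarrow> B # \<Gamma> \<turnstile> lift 0 A type"
  by (rule weakening_lift(2)[OF _ weakening_0])

lemma lift_term: "\<Gamma> \<turnstile> B type \<Longrightarrow> \<Gamma> \<turnstile> t : A \<Longrightarrow> B # \<Gamma> \<turnstile> lift 0 t : lift 0 A"
  by (rule weakening_lift(3)[OF _ weakening_0])

lemma inst_type: "A # \<Gamma> \<turnstile> B type \<Longrightarrow> \<Gamma> \<turnstile> a : A \<Longrightarrow> \<Gamma> \<turnstile> inst B a type"
  by (rule substitution_subst(2)[OF _ substitution_0])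

lemma ctx_nth_type:
  assumes "ctx \<Gamma>" "i < length \<Gamma>"
  shows "\<Gamma> \<turnstile> (lift 0 ^^ Suc i) (\<Gamma> ! i) type"
  using assms
proof (induction \<Gamma> arbitrary: i rule: list.induct)
  case (Cons A \<Gamma>)
  from Cons.prems(1) have A: "\<Gamma> \<turnstile> A type" by (auto elim: ctx.cases)
  with Cons show ?case by (cases i) (auto intro: lift_type type_ctx)
qed simp

text \<open>Conversion changes the type but never the subject, so a derivation for a type former
  goes back to its universe rule. No injectivity of type formers under \<open>\<approx>\<close> is
  required.\<close>

lemma univ_inversion:
  "\<Gamma> \<turnstile> t : T \<Longrightarrow>
     (\<forall>A B. t = Pi A B \<or> t = Sig A B \<longrightarrow> \<Gamma> \<turnstile> A : Univ \<and> A # \<Gamma> \<turnstile> B : Univ) \<and>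
     (\<forall>A B. t = Sum A B \<longrightarrow> \<Gamma> \<turnstile> A : Univ \<and> \<Gamma> \<turnstile> B : Univ) \<and>
     (\<forall>A a b. t = Eq A a b \<longrightarrow> \<Gamma> \<turnstile> A : Univ \<and> \<Gamma> \<turnstile> a : A \<and> \<Gamma> \<turnstile> b : A) \<and>
     (\<forall>A. t = Trunc A \<longrightarrow> \<Gamma> \<turnstile> A : Univ)"
  by (induction rule: ctx_is_type_has_type.inducts(3)[where ?P1.0 = "\<lambda>_. True" and ?P2.0 = "\<lambda>_ _. True"])
    simp_all

lemma Pi_type_inversion: "\<Gamma> \<turnstile> Pi A B type \<Longrightarrow> \<Gamma> \<turnstile> A type \<and> A # \<Gamma> \<turnstile> B type"
  by (erule is_type.cases) (auto dest!: univ_inversion intro: type_El)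

lemma Sig_type_inversion: "\<Gamma> \<turnstile> Sig A B type \<Longrightarrow> \<Gamma> \<turnstile> A type \<and> A # \<Gamma> \<turnstile> B type"
  by (erule is_type.cases) (auto dest!: univ_inversion intro: type_El)

lemma Sum_type_inversion: "\<Gamma> \<turnstile> Sum A B type \<Longrightarrow> \<Gamma> \<turnstile> A type \<and> \<Gamma> \<turnstile> B type"
  by (erule is_type.cases) (auto dest!: univ_inversion intro: type_El)

lemma Eq_type_inversion: "\<Gamma> \<turnstile> Eq A a b type \<Longrightarrow> \<Gamma> \<turnstile> A type \<and> \<Gamma> \<turnstile> a : A \<and> \<Gamma> \<turnstile> b : A"
  by (erule is_type.cases) (auto dest!: univ_inversion intro: type_El)

lemma Trunc_type_inversion: "\<Gamma> \<turnstile> Trunc A type \<Longrightarrow> \<Gamma> \<turnstile> A type"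
  by (erule is_type.cases) (auto dest!: univ_inversion intro: type_El)


lemma inst2_type:
  assumes "Eq (lift 0 A) (lift 0 a) (Var 0) # A # \<Gamma> \<turnstile> C type" "\<Gamma> \<turnstile> b : A" "\<Gamma> \<turnstile> e : Eq A a b"
  shows "\<Gamma> \<turnstile> inst2 C b e type"
proof -
  \<comment> \<open>\<open>inst2\<close> replaces the path first. Here the endpoint goes first, so
    that the context entry of the path becomes \<open>Eq A a b\<close> and fits \<open>e\<close>;
    \<open>subst_subst\<close> exchanges the two orders.\<close>
  have "substitution (Suc 0) (lift 0 b) (Eq (lift 0 A) (lift 0 a) (Var 0) # A # \<Gamma>) (Eq A a b # \<Gamma>)"
    using substitution_Suc[OF substitution_0[OF assms(2)], of "Eq (lift 0 A) (lift 0 a) (Var 0)"] by simp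
  from inst_type[OF substitution_subst(2)[OF assms(1) this] assms(3)] show ?thesis
    using subst_subst[of 0 0 b "lift 0 e" C] by simp
qed

lemma IsProp_type:
  assumes "\<Gamma> \<turnstile> A type"
  shows "\<Gamma> \<turnstile> IsProp A type"
proof -
  from assms have A': "A # \<Gamma> \<turnstile> lift 0 A type" by (blast intro: lift_type)
  let ?\<Gamma> = "lift 0 A # A # \<Gamma>"
  have "ctx ?\<Gamma>" using A' by (rule ctx_Cons)
  from var[OF this, of 0] var[OF this, of 1] lift_type[OF A' A'] show ?thesis
    unfolding IsProp_def by (auto intro!: type_Pi assms A' type_Eq)
qed

text \<open>Supplies the well-formedness of inferred types, from which inversion extracts the
  premises that a typing rule has on its component types.\<close>

lemma validity: "\<Gamma> \<turnstile> t : A \<Longrightarrow> \<Gamma> \<turnstile> A type"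
proof (induction rule: ctx_is_type_has_type.inducts(3)[where ?P1.0 = "\<lambda>_. True" and ?P2.0 = "\<lambda>_ _. True"])
  case (Eq_elim A a \<Gamma> C d p b)
  then show ?case by (blast intro: inst2_type dest: Eq_type_inversion)
next
  case (Trunc_prop \<Gamma> A)
  then show ?case by (blast intro: type_Trunc IsProp_type)
next
  case (funext \<Gamma> f A B g h)
  then show ?case by (blast intro: type_Eq)
next
  case (var \<Gamma> i)
  then show ?case by (blast intro: ctx_nth_type)
next
  case (conversion \<Gamma> t A B)
  then show ?case by simp
next
  case (Pi_elim \<Gamma> f A B a)
  then show ?case by (blast intro: inst_type dest: Pi_type_inversion)
next
  case (Sig_intro A \<Gamma> B a b)
  then show ?case by (simp add: type_Sig)
next
  case (Sum_introL \<Gamma> B a A)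
  then show ?case by (simp add: type_Sum)
next
  case (Sum_introR \<Gamma> A b B)
  then show ?case by (simp add: type_Sum)
next
  case (Pi_intro \<Gamma> A b B)
  then show ?case by (simp add: type_Pi)
next
  case (Eq_intro \<Gamma> a A)
  then show ?case by (simp add: type_Eq)
next
  case (Trunc_intro \<Gamma> a A)
  then show ?case by (simp add: type_Trunc)
next
  case (propext \<Gamma> P Q)
  then show ?case by (simp add: type_Eq)
qed (simp add: inst_type type_Univ; (rule type_El, rule typing_rules, assumption))+

lemma inst_Var_lift: "subst k (Var k) (lift (Suc k) t) = t"
  by (induction t arbitrary: k) auto

lemma Arr_type: "\<Gamma> \<turnstile> A type \<Longrightarrow> \<Gamma> \<turnstile> B type \<Longrightarrow> \<Gamma> \<turnstile> Arr A B type"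
  by (blast intro: type_Pi lift_type)

text \<open>A term typed in a context of length at most \<open>k\<close> has no free index from
  \<open>k\<close> on, so lifting there is vacuous.\<close>

lemma scoped:
  shows "ctx \<Gamma> \<Longrightarrow> True"
    and "\<Gamma> \<turnstile> A type \<Longrightarrow> length \<Gamma> \<le> k \<Longrightarrow> lift k A = A"
    and "\<Gamma> \<turnstile> t : A \<Longrightarrow> length \<Gamma> \<le> k \<Longrightarrow> lift k t = t"
  by (induction arbitrary: and k and k rule: ctx_is_type_has_type.inducts) simp_all

lemma scoped_subst_type: "\<Gamma> \<turnstile> A type \<Longrightarrow> length \<Gamma> \<le> k \<Longrightarrow> subst k u A = A"
  by (metis scoped(2) subst_lift)

lemma scoped_subst_term: "\<Gamma> \<turnstile> t : A \<Longrightarrow> length \<Gamma> \<le> k \<Longrightarrow> subst k u t = t"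
  by (metis scoped(3) subst_lift)

lemma weaken_closed_type: "[] \<turnstile> A type \<Longrightarrow> ctx \<Gamma> \<Longrightarrow> \<Gamma> \<turnstile> A type"
proof (induction \<Gamma> rule: list.induct)
  case (Cons B \<Gamma>)
  then have B: "\<Gamma> \<turnstile> B type" by (auto elim: ctx.cases)
  with Cons have "\<Gamma> \<turnstile> A type" by (blast intro: type_ctx)
  from lift_type[OF B this] scoped(2)[OF Cons.prems(1), of 0] show ?case by simp
qed

lemma weaken_closed1:
  assumes "[A] \<turnstile> t : T"
  shows "ctx \<Gamma> \<Longrightarrow> A # \<Gamma> \<turnstile> t : T"
proof (induction \<Gamma> rule: list.induct)
  case (Cons B \<Gamma>)
  then have B: "\<Gamma> \<turnstile> B type" by (auto elim: ctx.cases)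
  with Cons have t: "A # \<Gamma> \<turnstile> t : T" by (blast intro: type_ctx)
  have A: "[] \<turnstile> A type" using term_ctx[OF assms] by (auto elim: ctx.cases)
  from weakening_lift(3)[OF t weakening_Suc[OF weakening_0[OF B]]]
  show ?case using scoped(2)[OF A, of 0] scoped(3)[OF assms, of "Suc 0"]
    scoped(2)[OF validity[OF assms], of "Suc 0"] by simp
qed (simp add: assms)

text \<open>Only the argument is affected, because \<open>t\<close> has no other free variable. This
  makes \<open>computable_two\<close> a family that can stay folded under lifting and
  substitution.\<close>

lemma lift_inst1: "[A] \<turnstile> t : T \<Longrightarrow> lift k (inst t a) = inst t (lift k a)"
  by (simp add: lift_subst_ge scoped(3))

lemma subst_inst1: "[A] \<turnstile> t : T \<Longrightarrow> subst k u (inst t a) = inst t (subst k u a)"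
  by (subst subst_subst) (simp_all add: scoped_subst_term)

lemma inst1_typed:
  assumes "[A] \<turnstile> t : T" "\<Gamma> \<turnstile> a : A"
  shows "\<Gamma> \<turnstile> inst t a : inst T a"
  using substitution_subst(3)[OF weaken_closed1[OF assms(1) term_ctx[OF assms(2)]] substitution_0[OF assms(2)]] .


section \<open>A type checker\<close>

text \<open>Performs \<open>m\<close> liftings in one traversal, so that reading a variable's type
  from the context takes a single pass at any depth.\<close>

primrec shift :: "nat \<Rightarrow> nat \<Rightarrow> tm \<Rightarrow> tm" where
  "shift m k (Var i) = Var (if i < k then i else m + i)"
| "shift m k Univ = Univ"
| "shift m k (Pi a b) = Pi (shift m k a) (shift m (Suc k) b)"
| "shift m k (Lam a b) = Lam (shift m k a) (shift m (Suc k) b)"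
| "shift m k (App a b) = App (shift m k a) (shift m k b)"
| "shift m k (Sig a b) = Sig (shift m k a) (shift m (Suc k) b)"
| "shift m k (Pair a b) = Pair (shift m k a) (shift m k b)"
| "shift m k (Split a b c) = Split (shift m (Suc k) a) (shift m k b) (shift m k c)"
| "shift m k (Sum a b) = Sum (shift m k a) (shift m k b)"
| "shift m k (InL a) = InL (shift m k a)"
| "shift m k (InR a) = InR (shift m k a)"
| "shift m k (Case a b c d) = Case (shift m (Suc k) a) (shift m k b) (shift m k c) (shift m k d)"
| "shift m k Empty = Empty"
| "shift m k (Absurd a b) = Absurd (shift m k a) (shift m k b)"
| "shift m k Unit = Unit"
| "shift m k Star = Star"
| "shift m k (UnitElim a b c) = UnitElim (shift m (Suc k) a) (shift m k b) (shift m k c)"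
| "shift m k Two = Two"
| "shift m k Two0 = Two0"
| "shift m k Two1 = Two1"
| "shift m k (TwoElim a b c d) = TwoElim (shift m (Suc k) a) (shift m k b) (shift m k c) (shift m k d)"
| "shift m k Nat = Nat"
| "shift m k Zero = Zero"
| "shift m k (Succ a) = Succ (shift m k a)"
| "shift m k (NatElim a b c d) = NatElim (shift m (Suc k) a) (shift m k b) (shift m k c) (shift m k d)"
| "shift m k (Eq a b c) = Eq (shift m k a) (shift m k b) (shift m k c)"
| "shift m k (Refl a) = Refl (shift m k a)"
| "shift m k (J a b c) = J (shift m (Suc (Suc k)) a) (shift m k b) (shift m k c)"
| "shift m k (Trunc a) = Trunc (shift m k a)"
| "shift m k (TruncIn a) = TruncIn (shift m k a)"
| "shift m k (TruncProp a) = TruncProp (shift m k a)"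
| "shift m k (TruncElim a b c) = TruncElim (shift m k a) (shift m k b) (shift m k c)"
| "shift m k (FunExt a) = FunExt (shift m k a)"
| "shift m k (PropExt a b c d) = PropExt (shift m k a) (shift m k b) (shift m k c) (shift m k d)"

lemma shift_0: "shift 0 k t = t"
  by (induction t arbitrary: k) auto

lemma lift_shift: "lift k (shift m k t) = shift (Suc m) k t"
  by (induction t arbitrary: k) auto

lemma shift_funpow: "shift m 0 t = (lift 0 ^^ m) t"
  by (induction m) (simp_all add: shift_0 flip: lift_shift)

section \<open>Weak head reduction with fuel\<close>

fun app_redex :: "(tm \<Rightarrow> tm) \<Rightarrow> tm \<Rightarrow> tm \<Rightarrow> tm" where
  "app_redex W a (Lam A b) = W (inst b a)"
| "app_redex W a f = App f a"

fun split_redex :: "(tm \<Rightarrow> tm) \<Rightarrow> tm \<Rightarrow> tm \<Rightarrow> tm \<Rightarrow> tm" where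
  "split_redex W C d (Pair a b) = W (App (App d a) b)"
| "split_redex W C d p = Split C d p"

fun case_redex :: "(tm \<Rightarrow> tm) \<Rightarrow> tm \<Rightarrow> tm \<Rightarrow> tm \<Rightarrow> tm \<Rightarrow> tm" where
  "case_redex W C l r (InL a) = W (App l a)"
| "case_redex W C l r (InR b) = W (App r b)"
| "case_redex W C l r t = Case C l r t"

fun unit_redex :: "(tm \<Rightarrow> tm) \<Rightarrow> tm \<Rightarrow> tm \<Rightarrow> tm \<Rightarrow> tm" where
  "unit_redex W C c Star = W c"
| "unit_redex W C c t = UnitElim C c t"

fun two_redex :: "(tm \<Rightarrow> tm) \<Rightarrow> tm \<Rightarrow> tm \<Rightarrow> tm \<Rightarrow> tm \<Rightarrow> tm" where
  "two_redex W C a b Two0 = W a"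
| "two_redex W C a b Two1 = W b"
| "two_redex W C a b t = TwoElim C a b t"

fun nat_redex :: "(tm \<Rightarrow> tm) \<Rightarrow> tm \<Rightarrow> tm \<Rightarrow> tm \<Rightarrow> tm \<Rightarrow> tm" where
  "nat_redex W C z s Zero = W z"
| "nat_redex W C z s (Succ n) = W (App (App s n) (NatElim C z s n))"
| "nat_redex W C z s t = NatElim C z s t"

fun J_redex :: "(tm \<Rightarrow> tm) \<Rightarrow> tm \<Rightarrow> tm \<Rightarrow> tm \<Rightarrow> tm" where
  "J_redex W C d (Refl a) = W d"
| "J_redex W C d p = J C d p"

fun whnf_step :: "(tm \<Rightarrow> tm) \<Rightarrow> tm \<Rightarrow> tm" where
  "whnf_step W (App f a) = app_redex W a (W f)"
| "whnf_step W (Split C d p) = split_redex W C d (W p)"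
| "whnf_step W (Case C l r p) = case_redex W C l r (W p)"
| "whnf_step W (UnitElim C c p) = unit_redex W C c (W p)"
| "whnf_step W (TwoElim C a b p) = two_redex W C a b (W p)"
| "whnf_step W (NatElim C z s p) = nat_redex W C z s (W p)"
| "whnf_step W (J C d p) = J_redex W C d (W p)"
| "whnf_step W t = t"

text \<open>When the fuel runs out the term is returned as it stands. It is still convertible to the
  original, so only completeness suffers.\<close>

primrec whnf :: "nat \<Rightarrow> tm \<Rightarrow> tm" where
  "whnf 0 t = t"
| "whnf (Suc n) t = whnf_step (whnf n) t"

context
  fixes W :: "tm \<Rightarrow> tm"
  assumes W: "\<And>t. t \<approx> W t"
begin

lemma app_redex_conv: "App f a \<approx> app_redex W a f"
  by (cases f) (auto intro: conv.refl conv.trans[OF beta W])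

lemma split_redex_conv: "Split C d p \<approx> split_redex W C d p"
  by (cases p) (auto intro: conv.refl conv.trans[OF split_pair W])

lemma case_redex_conv: "Case C l r p \<approx> case_redex W C l r p"
  by (cases p) (auto intro: conv.refl conv.trans[OF case_inl W] conv.trans[OF case_inr W])

lemma unit_redex_conv: "UnitElim C c p \<approx> unit_redex W C c p"
  by (cases p) (auto intro: conv.refl conv.trans[OF unit_star W])

lemma two_redex_conv: "TwoElim C a b p \<approx> two_redex W C a b p"
  by (cases p) (auto intro: conv.refl conv.trans[OF two_0 W] conv.trans[OF two_1 W])

lemma nat_redex_conv: "NatElim C z s p \<approx> nat_redex W C z s p"
  by (cases p) (auto intro: conv.refl conv.trans[OF nat_zero W] conv.trans[OF nat_succ W])

lemma J_redex_conv: "J C d p \<approx> J_redex W C d p"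
  by (cases p) (auto intro: conv.refl conv.trans[OF J_refl W])

lemma whnf_step_conv: "t \<approx> whnf_step W t"
proof (cases t)
  case (App f a)
  then show ?thesis using conv.trans[OF cong_App[OF W conv.refl] app_redex_conv] by simp
next
  case (Split C d p)
  then show ?thesis using conv.trans[OF cong_Split[OF conv.refl conv.refl W] split_redex_conv] by simp
next
  case (Case C l r p)
  then show ?thesis
    using conv.trans[OF cong_Case[OF conv.refl conv.refl conv.refl W] case_redex_conv] by simp
next
  case (UnitElim C c p)
  then show ?thesis using conv.trans[OF cong_UnitElim[OF conv.refl conv.refl W] unit_redex_conv] by simp
next
  case (TwoElim C a b p)
  then show ?thesis
    using conv.trans[OF cong_TwoElim[OF conv.refl conv.refl conv.refl W] two_redex_conv] by simp
next
  case (NatElim C z s p)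
  then show ?thesis
    using conv.trans[OF cong_NatElim[OF conv.refl conv.refl conv.refl W] nat_redex_conv] by simp
next
  case (J C d p)
  then show ?thesis using conv.trans[OF cong_J[OF conv.refl conv.refl W] J_redex_conv] by simp
qed (simp_all add: conv.refl)

end

lemma whnf_conv: "t \<approx> whnf n t"
  by (induction n arbitrary: t) (simp_all add: conv.refl whnf_step_conv)

section \<open>Comparing terms up to conversion\<close>

primrec head :: "tm \<Rightarrow> tm" where
  "head (Var i) = Var i"
| "head Univ = Univ"
| "head (Pi a b) = Pi Star Star"
| "head (Lam a b) = Lam Star Star"
| "head (App a b) = App Star Star"
| "head (Sig a b) = Sig Star Star"
| "head (Pair a b) = Pair Star Star"
| "head (Split a b c) = Split Star Star Star"
| "head (Sum a b) = Sum Star Star"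
| "head (InL a) = InL Star"
| "head (InR a) = InR Star"
| "head (Case a b c d) = Case Star Star Star Star"
| "head Empty = Empty"
| "head (Absurd a b) = Absurd Star Star"
| "head Unit = Unit"
| "head Star = Star"
| "head (UnitElim a b c) = UnitElim Star Star Star"
| "head Two = Two"
| "head Two0 = Two0"
| "head Two1 = Two1"
| "head (TwoElim a b c d) = TwoElim Star Star Star Star"
| "head Nat = Nat"
| "head Zero = Zero"
| "head (Succ a) = Succ Star"
| "head (NatElim a b c d) = NatElim Star Star Star Star"
| "head (Eq a b c) = Eq Star Star Star"
| "head (Refl a) = Refl Star"
| "head (J a b c) = J Star Star Star"
| "head (Trunc a) = Trunc Star"
| "head (TruncIn a) = TruncIn Star"
| "head (TruncProp a) = TruncProp Star"
| "head (TruncElim a b c) = TruncElim Star Star Star"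
| "head (FunExt a) = FunExt Star"
| "head (PropExt a b c d) = PropExt Star Star Star Star"

primrec children :: "tm \<Rightarrow> tm list" where
  "children (Var i) = []"
| "children Univ = []"
| "children (Pi a b) = [a, b]"
| "children (Lam a b) = [a, b]"
| "children (App a b) = [a, b]"
| "children (Sig a b) = [a, b]"
| "children (Pair a b) = [a, b]"
| "children (Split a b c) = [a, b, c]"
| "children (Sum a b) = [a, b]"
| "children (InL a) = [a]"
| "children (InR a) = [a]"
| "children (Case a b c d) = [a, b, c, d]"
| "children Empty = []"
| "children (Absurd a b) = [a, b]"
| "children Unit = []"
| "children Star = []"
| "children (UnitElim a b c) = [a, b, c]"
| "children Two = []"
| "children Two0 = []"
| "children Two1 = []"
| "children (TwoElim a b c d) = [a, b, c, d]"
| "children Nat = []"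
| "children Zero = []"
| "children (Succ a) = [a]"
| "children (NatElim a b c d) = [a, b, c, d]"
| "children (Eq a b c) = [a, b, c]"
| "children (Refl a) = [a]"
| "children (J a b c) = [a, b, c]"
| "children (Trunc a) = [a]"
| "children (TruncIn a) = [a]"
| "children (TruncProp a) = [a]"
| "children (TruncElim a b c) = [a, b, c]"
| "children (FunExt a) = [a]"
| "children (PropExt a b c d) = [a, b, c, d]"

text \<open>All congruence rules in one: \<open>head\<close> blanks the subterms with a dummy
  \<open>Star\<close>, so that one equality test compares constructors. Binders need no special care
  because conversion carries no context.\<close>

lemma conv_head_children:
  "head t = head u \<Longrightarrow> list_all2 (\<approx>) (children t) (children u) \<Longrightarrow> t \<approx> u"
  by (cases t; cases u; simp; blast intro: conv.intros)

text \<open>The boolean acts as a guard: the recursive comparison appears only once the heads are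
  known to agree.\<close>

fun conv_children :: "(tm \<Rightarrow> tm \<Rightarrow> bool) \<Rightarrow> tm list \<Rightarrow> tm list \<Rightarrow> bool \<Rightarrow> bool" where
  "conv_children R ts us True = list_all2 R ts us"
| "conv_children R ts us False = False"

definition conv_whnf :: "(tm \<Rightarrow> tm \<Rightarrow> bool) \<Rightarrow> tm \<Rightarrow> tm \<Rightarrow> bool" where
  "conv_whnf R t u = conv_children R (children t) (children u) (head t = head u)"

fun conv_step :: "(tm \<Rightarrow> tm \<Rightarrow> bool) \<Rightarrow> (tm \<Rightarrow> tm) \<Rightarrow> tm \<Rightarrow> tm \<Rightarrow> bool \<Rightarrow> bool" where
  "conv_step R W t u True = True"
| "conv_step R W t u False = conv_whnf R (W t) (W u)"

primrec conv_check :: "nat \<Rightarrow> tm \<Rightarrow> tm \<Rightarrow> bool" where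
  "conv_check 0 t u = False"
| "conv_check (Suc n) t u = conv_step (conv_check n) (whnf n) t u (t = u)"

lemma conv_check_sound: "conv_check n t u \<Longrightarrow> t \<approx> u"
proof (induction n arbitrary: t u)
  case (Suc n)
  show ?case
  proof (cases "t = u")
    case False
    with Suc.prems have "head (whnf n t) = head (whnf n u)"
      "list_all2 (conv_check n) (children (whnf n t)) (children (whnf n u))"
      by (auto simp: conv_whnf_def elim: conv_children.elims)
    then have "whnf n t \<approx> whnf n u"
      using Suc.IH by (blast intro: conv_head_children list_all2_mono)
    then show ?thesis by (blast intro: conv.trans conv.sym whnf_conv)
  qed (simp add: conv.refl)
qed simp

text \<open>
  Queries are data, and every function below is defined by equations on constructor patterns.
  Simplification then evaluates the checker without case combinators, whose congruence rules would
  force it to traverse the context again after every step.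
\<close>

datatype query = Infer "tm list" tm | Check "tm list" tm tm | CheckType "tm list" tm | Conv tm tm

primrec keep :: "tm option \<Rightarrow> tm option \<Rightarrow> tm option" where
  "keep None y = None"
| "keep (Some r) y = y"

primrec all_ok :: "(query \<Rightarrow> tm option) \<Rightarrow> tm \<Rightarrow> query list \<Rightarrow> tm option" where
  "all_ok R T [] = Some T"
| "all_ok R T (q # qs) = keep (R q) (all_ok R T qs)"

primrec if_true :: "bool \<Rightarrow> tm \<Rightarrow> tm option" where
  "if_true True T = Some T"
| "if_true False T = None"

fun lookup :: "nat \<Rightarrow> tm list \<Rightarrow> nat \<Rightarrow> tm option" where
  "lookup m [] i = None"
| "lookup m (A # \<Gamma>) 0 = Some (shift m 0 A)"
| "lookup m (A # \<Gamma>) (Suc i) = lookup (Suc m) \<Gamma> i"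

text \<open>Well-formedness of a reduct is tested instead of being deduced from that of the original
  type, which would take subject reduction.\<close>

definition recheck :: "(query \<Rightarrow> tm option) \<Rightarrow> tm list \<Rightarrow> tm \<Rightarrow> tm option" where
  "recheck R \<Gamma> T = all_ok R T [CheckType \<Gamma> T]"

text \<open>A type that already shows its former passes untouched, so the cost of
  \<open>recheck\<close> arises only after an actual reduction.\<close>

fun expose :: "(query \<Rightarrow> tm option) \<Rightarrow> (tm \<Rightarrow> tm) \<Rightarrow> tm list \<Rightarrow> tm \<Rightarrow> tm option" where
  "expose R W \<Gamma> (Pi A B) = Some (Pi A B)"
| "expose R W \<Gamma> (Sig A B) = Some (Sig A B)"
| "expose R W \<Gamma> (Sum A B) = Some (Sum A B)"
| "expose R W \<Gamma> (Eq A a b) = Some (Eq A a b)"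
| "expose R W \<Gamma> (Trunc A) = Some (Trunc A)"
| "expose R W \<Gamma> T = recheck R \<Gamma> (W T)"

primrec expose_opt :: "(query \<Rightarrow> tm option) \<Rightarrow> (tm \<Rightarrow> tm) \<Rightarrow> tm list \<Rightarrow> tm option \<Rightarrow> tm option" where
  "expose_opt R W \<Gamma> None = None"
| "expose_opt R W \<Gamma> (Some T) = expose R W \<Gamma> T"

fun infer_Lam :: "tm \<Rightarrow> tm option \<Rightarrow> tm option" where
  "infer_Lam A (Some B) = Some (Pi A B)"
| "infer_Lam A None = None"

fun infer_App :: "(query \<Rightarrow> tm option) \<Rightarrow> tm list \<Rightarrow> tm \<Rightarrow> tm option \<Rightarrow> tm option" where
  "infer_App R \<Gamma> a (Some (Pi A B)) = all_ok R (inst B a) [Check \<Gamma> a A]"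
| "infer_App R \<Gamma> a F = None"

fun infer_Split ::
  "(query \<Rightarrow> tm option) \<Rightarrow> tm list \<Rightarrow> tm \<Rightarrow> tm \<Rightarrow> tm \<Rightarrow> tm option \<Rightarrow> tm option" where
  "infer_Split R \<Gamma> C d p (Some (Sig A B)) =
     all_ok R (inst C p) [CheckType (Sig A B # \<Gamma>) C,
       Check \<Gamma> d (Pi A (Pi B (inst_under2 C (Pair (Var 1) (Var 0)))))]"
| "infer_Split R \<Gamma> C d p S = None"

fun infer_Case ::
  "(query \<Rightarrow> tm option) \<Rightarrow> tm list \<Rightarrow> tm \<Rightarrow> tm \<Rightarrow> tm \<Rightarrow> tm \<Rightarrow> tm option \<Rightarrow> tm option" where
  "infer_Case R \<Gamma> C l r s (Some (Sum A B)) =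
     all_ok R (inst C s) [CheckType (Sum A B # \<Gamma>) C,
       Check \<Gamma> l (Pi A (inst_under1 C (InL (Var 0)))), Check \<Gamma> r (Pi B (inst_under1 C (InR (Var 0))))]"
| "infer_Case R \<Gamma> C l r s S = None"

fun infer_Refl :: "tm \<Rightarrow> tm option \<Rightarrow> tm option" where
  "infer_Refl a (Some A) = Some (Eq A a a)"
| "infer_Refl a None = None"

fun infer_J ::
  "(query \<Rightarrow> tm option) \<Rightarrow> tm list \<Rightarrow> tm \<Rightarrow> tm \<Rightarrow> tm \<Rightarrow> tm option \<Rightarrow> tm option" where
  "infer_J R \<Gamma> C d p (Some (Eq A a b)) =
     all_ok R (inst2 C b p) [CheckType (Eq (lift 0 A) (lift 0 a) (Var 0) # A # \<Gamma>) C,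
       Check \<Gamma> d (inst2 C a (Refl a))]"
| "infer_J R \<Gamma> C d p E = None"

fun infer_TruncIn :: "tm option \<Rightarrow> tm option" where
  "infer_TruncIn (Some A) = Some (Trunc A)"
| "infer_TruncIn None = None"

text \<open>\<open>TruncElim\<close> carries no motive. The target \<open>B\<close> is recovered as
  the domain of the inferred type \<open>Pi B X\<close> of \<open>h\<close>, which is then compared
  with \<open>IsProp B\<close>.\<close>

fun infer_TruncElim_arg ::
  "(query \<Rightarrow> tm option) \<Rightarrow> tm list \<Rightarrow> tm \<Rightarrow> tm \<Rightarrow> tm \<Rightarrow> tm option \<Rightarrow> tm option" where
  "infer_TruncElim_arg R \<Gamma> f B X (Some (Trunc A)) =
     all_ok R B [Conv (Pi B X) (IsProp B), Check \<Gamma> f (Arr A B)]"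
| "infer_TruncElim_arg R \<Gamma> f B X S = None"

fun infer_TruncElim ::
  "(query \<Rightarrow> tm option) \<Rightarrow> tm list \<Rightarrow> tm \<Rightarrow> tm option \<Rightarrow> tm option \<Rightarrow> tm option" where
  "infer_TruncElim R \<Gamma> f S (Some (Pi B X)) = infer_TruncElim_arg R \<Gamma> f B X S"
| "infer_TruncElim R \<Gamma> f S H = None"

text \<open>The synthesising half of a bidirectional checker. \<open>Pair\<close>,
  \<open>InL\<close>, \<open>InR\<close>, \<open>FunExt\<close> and \<open>PropExt\<close> do not
  determine their types and can only be checked; \<open>Univ\<close> is a type but not an element of
  one.\<close>

fun infer_step :: "(query \<Rightarrow> tm option) \<Rightarrow> (tm \<Rightarrow> tm) \<Rightarrow> tm list \<Rightarrow> tm \<Rightarrow> tm option" where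
  "infer_step R W \<Gamma> (Var i) = lookup 1 \<Gamma> i"
| "infer_step R W \<Gamma> (Pi A B) = all_ok R Univ [Check \<Gamma> A Univ, Check (A # \<Gamma>) B Univ]"
| "infer_step R W \<Gamma> (Sig A B) = all_ok R Univ [Check \<Gamma> A Univ, Check (A # \<Gamma>) B Univ]"
| "infer_step R W \<Gamma> (Sum A B) = all_ok R Univ [Check \<Gamma> A Univ, Check \<Gamma> B Univ]"
| "infer_step R W \<Gamma> (Eq A a b) = all_ok R Univ [Check \<Gamma> A Univ, Check \<Gamma> a A, Check \<Gamma> b A]"
| "infer_step R W \<Gamma> (Trunc A) = all_ok R Univ [Check \<Gamma> A Univ]"
| "infer_step R W \<Gamma> Empty = Some Univ"
| "infer_step R W \<Gamma> Unit = Some Univ"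
| "infer_step R W \<Gamma> Two = Some Univ"
| "infer_step R W \<Gamma> Nat = Some Univ"
| "infer_step R W \<Gamma> (Lam A b) =
     keep (R (CheckType \<Gamma> A)) (infer_Lam A (R (Infer (A # \<Gamma>) b)))"
| "infer_step R W \<Gamma> (App f a) = infer_App R \<Gamma> a (expose_opt R W \<Gamma> (R (Infer \<Gamma> f)))"
| "infer_step R W \<Gamma> (Split C d p) = infer_Split R \<Gamma> C d p (expose_opt R W \<Gamma> (R (Infer \<Gamma> p)))"
| "infer_step R W \<Gamma> (Case C l r s) = infer_Case R \<Gamma> C l r s (expose_opt R W \<Gamma> (R (Infer \<Gamma> s)))"
| "infer_step R W \<Gamma> (Absurd C s) = all_ok R C [CheckType \<Gamma> C, Check \<Gamma> s Empty]"
| "infer_step R W \<Gamma> Star = Some Unit"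
| "infer_step R W \<Gamma> (UnitElim C c s) =
     all_ok R (inst C s) [Check \<Gamma> s Unit, CheckType (Unit # \<Gamma>) C, Check \<Gamma> c (inst C Star)]"
| "infer_step R W \<Gamma> Two0 = Some Two"
| "infer_step R W \<Gamma> Two1 = Some Two"
| "infer_step R W \<Gamma> (TwoElim C a b s) =
     all_ok R (inst C s) [Check \<Gamma> s Two, CheckType (Two # \<Gamma>) C,
       Check \<Gamma> a (inst C Two0), Check \<Gamma> b (inst C Two1)]"
| "infer_step R W \<Gamma> Zero = Some Nat"
| "infer_step R W \<Gamma> (Succ m) = all_ok R Nat [Check \<Gamma> m Nat]"
| "infer_step R W \<Gamma> (NatElim C z s m) =
     all_ok R (inst C m) [Check \<Gamma> m Nat, CheckType (Nat # \<Gamma>) C, Check \<Gamma> z (inst C Zero),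
       Check \<Gamma> s (Pi Nat (Pi C (inst_under2 C (Succ (Var 1)))))]"
| "infer_step R W \<Gamma> (Refl a) = infer_Refl a (R (Infer \<Gamma> a))"
| "infer_step R W \<Gamma> (J C d p) = infer_J R \<Gamma> C d p (expose_opt R W \<Gamma> (R (Infer \<Gamma> p)))"
| "infer_step R W \<Gamma> (TruncIn a) = infer_TruncIn (R (Infer \<Gamma> a))"
| "infer_step R W \<Gamma> (TruncProp A) = all_ok R (IsProp (Trunc A)) [CheckType \<Gamma> (Trunc A)]"
| "infer_step R W \<Gamma> (TruncElim h f s) =
     infer_TruncElim R \<Gamma> f (expose_opt R W \<Gamma> (R (Infer \<Gamma> s))) (R (Infer \<Gamma> h))"
| "infer_step R W \<Gamma> t = None"

fun convert :: "(query \<Rightarrow> tm option) \<Rightarrow> tm \<Rightarrow> tm option \<Rightarrow> tm option" where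
  "convert R T (Some T') = all_ok R T [Conv T' T]"
| "convert R T None = None"

text \<open>If the annotation is literally the expected domain, its well-formedness is already
  presupposed. Otherwise the body is checked under the annotation, which
  \<open>context_conversion\<close> justifies.\<close>

fun check_Lam_body :: "(query \<Rightarrow> tm option) \<Rightarrow> tm list \<Rightarrow> tm \<Rightarrow> tm \<Rightarrow> tm \<Rightarrow> tm \<Rightarrow> bool \<Rightarrow> tm option" where
  "check_Lam_body R \<Gamma> A b A' B True = R (Check (A # \<Gamma>) b B)"
| "check_Lam_body R \<Gamma> A b A' B False =
     all_ok R Star [CheckType \<Gamma> A, Conv A A', Check (A # \<Gamma>) b B]"

fun check_Lam :: "(query \<Rightarrow> tm option) \<Rightarrow> tm list \<Rightarrow> tm \<Rightarrow> tm \<Rightarrow> tm option \<Rightarrow> tm option" where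
  "check_Lam R \<Gamma> A b (Some (Pi A' B)) = check_Lam_body R \<Gamma> A b A' B (A = A')"
| "check_Lam R \<Gamma> A b F = None"

fun check_Pair :: "(query \<Rightarrow> tm option) \<Rightarrow> tm list \<Rightarrow> tm \<Rightarrow> tm \<Rightarrow> tm option \<Rightarrow> tm option" where
  "check_Pair R \<Gamma> a b (Some (Sig A B)) = all_ok R Star [Check \<Gamma> a A, Check \<Gamma> b (inst B a)]"
| "check_Pair R \<Gamma> a b S = None"

fun check_InL :: "(query \<Rightarrow> tm option) \<Rightarrow> tm list \<Rightarrow> tm \<Rightarrow> tm option \<Rightarrow> tm option" where
  "check_InL R \<Gamma> a (Some (Sum A B)) = R (Check \<Gamma> a A)"
| "check_InL R \<Gamma> a S = None"

fun check_InR :: "(query \<Rightarrow> tm option) \<Rightarrow> tm list \<Rightarrow> tm \<Rightarrow> tm option \<Rightarrow> tm option" where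
  "check_InR R \<Gamma> b (Some (Sum A B)) = R (Check \<Gamma> b B)"
| "check_InR R \<Gamma> b S = None"

fun check_Refl :: "(query \<Rightarrow> tm option) \<Rightarrow> tm list \<Rightarrow> tm \<Rightarrow> tm option \<Rightarrow> tm option" where
  "check_Refl R \<Gamma> a (Some (Eq A x y)) = all_ok R Star [Check \<Gamma> a A, Conv a x, Conv a y]"
| "check_Refl R \<Gamma> a E = None"

fun check_TruncIn :: "(query \<Rightarrow> tm option) \<Rightarrow> tm list \<Rightarrow> tm \<Rightarrow> tm option \<Rightarrow> tm option" where
  "check_TruncIn R \<Gamma> a (Some (Trunc A)) = R (Check \<Gamma> a A)"
| "check_TruncIn R \<Gamma> a S = None"

fun check_FunExt_at :: "(query \<Rightarrow> tm option) \<Rightarrow> tm list \<Rightarrow> tm \<Rightarrow> tm \<Rightarrow> tm \<Rightarrow> tm \<Rightarrow> tm option" where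
  "check_FunExt_at R \<Gamma> h f g (Pi A B) =
     R (Check \<Gamma> h (Pi A (Eq B (App (lift 0 f) (Var 0)) (App (lift 0 g) (Var 0)))))"
| "check_FunExt_at R \<Gamma> h f g F = None"

fun check_FunExt :: "(query \<Rightarrow> tm option) \<Rightarrow> tm list \<Rightarrow> tm \<Rightarrow> tm option \<Rightarrow> tm option" where
  "check_FunExt R \<Gamma> h (Some (Eq F f g)) = check_FunExt_at R \<Gamma> h f g F"
| "check_FunExt R \<Gamma> h E = None"

fun check_PropExt ::
  "(query \<Rightarrow> tm option) \<Rightarrow> tm list \<Rightarrow> tm \<Rightarrow> tm \<Rightarrow> tm \<Rightarrow> tm \<Rightarrow> tm option \<Rightarrow> tm option" where
  "check_PropExt R \<Gamma> p q f g (Some (Eq U P Q)) =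
     all_ok R Star [Conv U Univ,
       Check \<Gamma> p (IsProp P), Check \<Gamma> q (IsProp Q), Check \<Gamma> f (Arr P Q), Check \<Gamma> g (Arr Q P)]"
| "check_PropExt R \<Gamma> p q f g E = None"

fun check_step :: "(query \<Rightarrow> tm option) \<Rightarrow> (tm \<Rightarrow> tm) \<Rightarrow> tm list \<Rightarrow> tm \<Rightarrow> tm \<Rightarrow> tm option" where
  "check_step R W \<Gamma> (Lam A b) T = check_Lam R \<Gamma> A b (expose R W \<Gamma> T)"
| "check_step R W \<Gamma> (Pair a b) T = check_Pair R \<Gamma> a b (expose R W \<Gamma> T)"
| "check_step R W \<Gamma> (InL a) T = check_InL R \<Gamma> a (expose R W \<Gamma> T)"
| "check_step R W \<Gamma> (InR b) T = check_InR R \<Gamma> b (expose R W \<Gamma> T)"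
| "check_step R W \<Gamma> (Refl a) T = check_Refl R \<Gamma> a (expose R W \<Gamma> T)"
| "check_step R W \<Gamma> (TruncIn a) T = check_TruncIn R \<Gamma> a (expose R W \<Gamma> T)"
| "check_step R W \<Gamma> (FunExt h) T = check_FunExt R \<Gamma> h (expose R W \<Gamma> T)"
| "check_step R W \<Gamma> (PropExt p q f g) T = check_PropExt R \<Gamma> p q f g (expose R W \<Gamma> T)"
| "check_step R W \<Gamma> t T = convert R T (R (Infer \<Gamma> t))"

text \<open>\<open>K\<close> recognises types that are known to be well formed and are not to be looked into.\<close>

primrec check_unless_known :: "(query \<Rightarrow> tm option) \<Rightarrow> query \<Rightarrow> bool \<Rightarrow> tm option" where
  "check_unless_known R q True = Some Star"
| "check_unless_known R q False = R q"

fun check_type_step ::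
  "(tm list \<Rightarrow> tm \<Rightarrow> bool) \<Rightarrow> (query \<Rightarrow> tm option) \<Rightarrow> tm list \<Rightarrow> tm \<Rightarrow> tm option" where
  "check_type_step K R \<Gamma> Univ = Some Star"
| "check_type_step K R \<Gamma> (Pi A B) = all_ok R Star [CheckType \<Gamma> A, CheckType (A # \<Gamma>) B]"
| "check_type_step K R \<Gamma> (Sig A B) = all_ok R Star [CheckType \<Gamma> A, CheckType (A # \<Gamma>) B]"
| "check_type_step K R \<Gamma> (Sum A B) = all_ok R Star [CheckType \<Gamma> A, CheckType \<Gamma> B]"
| "check_type_step K R \<Gamma> (Eq A a b) = all_ok R Star [CheckType \<Gamma> A, Check \<Gamma> a A, Check \<Gamma> b A]"
| "check_type_step K R \<Gamma> (Trunc A) = check_unless_known R (CheckType \<Gamma> A) (K \<Gamma> A)"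
| "check_type_step K R \<Gamma> T = R (Check \<Gamma> T Univ)"

primrec answer_step ::
  "(tm list \<Rightarrow> tm \<Rightarrow> bool) \<Rightarrow> (query \<Rightarrow> tm option) \<Rightarrow> nat \<Rightarrow> query \<Rightarrow> tm option" where
  "answer_step K R n (Infer \<Gamma> t) = infer_step R (whnf n) \<Gamma> t"
| "answer_step K R n (Check \<Gamma> t T) = check_step R (whnf n) \<Gamma> t T"
| "answer_step K R n (CheckType \<Gamma> T) = check_type_step K R \<Gamma> T"
| "answer_step K R n (Conv t u) = if_true (conv_check n t u) Star"

primrec answer :: "(tm list \<Rightarrow> tm \<Rightarrow> bool) \<Rightarrow> nat \<Rightarrow> query \<Rightarrow> tm option" where
  "answer K 0 q = None"
| "answer K (Suc n) q = answer_step K (answer K n) n q"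


section \<open>Soundness of the checker\<close>

lemma weaken_motive1:
  assumes "S # \<Gamma> \<turnstile> C type" "\<Gamma> \<turnstile> A type"
  shows "lift 0 S # A # \<Gamma> \<turnstile> lift (Suc 0) C type"
  using weakening_lift(2)[OF assms(1) weakening_Suc[OF weakening_0[OF assms(2)]]] .

lemma weaken_motive2:
  assumes "S # \<Gamma> \<turnstile> C type" "A # \<Gamma> \<turnstile> B type"
  shows "lift 0 (lift 0 S) # B # A # \<Gamma> \<turnstile> lift (Suc 0) (lift (Suc 0) C) type"
proof -
  have "\<Gamma> \<turnstile> A type" using type_ctx[OF assms(2)] by (auto elim: ctx.cases)
  from weaken_motive1[OF weaken_motive1[OF assms(1) this] assms(2)] show ?thesis .
qed

lemma inst_lift_lift: "inst (lift (Suc 0) (lift (Suc 0) B)) (Var (Suc 0)) = lift 0 B"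
  using lift_subst_ge[of 0 0 "Var 0" "lift (Suc 0) B"] inst_Var_lift[of 0 B] by simp

text \<open>Checking presupposes a well-formed type, so the branch types that the checker builds
  must be shown well formed from the motive. The three lemmas on branch and funext types that follow
  serve the same purpose.\<close>

lemma Split_branch_type:
  assumes "\<Gamma> \<turnstile> Sig A B type" "Sig A B # \<Gamma> \<turnstile> C type"
  shows "\<Gamma> \<turnstile> Pi A (Pi B (inst_under2 C (Pair (Var 1) (Var 0)))) type"
proof -
  from Sig_type_inversion[OF assms(1)] have A: "\<Gamma> \<turnstile> A type" and B: "A # \<Gamma> \<turnstile> B type" by auto
  from ctx_Cons[OF B] have \<Gamma>: "ctx (B # A # \<Gamma>)" .
  have "B # A # \<Gamma> \<turnstile> Pair (Var (Suc 0)) (Var 0) : lift 0 (lift 0 (Sig A B))"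
    using Sig_intro[OF weaken_motive2[OF B B], of "Var (Suc 0)" "Var 0"]
      var[OF \<Gamma>, of 0] var[OF \<Gamma>, of 1] by (simp add: inst_lift_lift lift_lift)
  from inst_type[OF weaken_motive2[OF assms(2) B] this] show ?thesis
    using A B by (simp add: type_Pi)
qed

lemma Case_branch_type:
  assumes "\<Gamma> \<turnstile> Sum A B type" "Sum A B # \<Gamma> \<turnstile> C type"
  shows "\<Gamma> \<turnstile> Pi A (inst_under1 C (InL (Var 0))) type"
    and "\<Gamma> \<turnstile> Pi B (inst_under1 C (InR (Var 0))) type"
proof -
  from Sum_type_inversion[OF assms(1)] have A: "\<Gamma> \<turnstile> A type" and B: "\<Gamma> \<turnstile> B type" by auto
  have "A # \<Gamma> \<turnstile> InL (Var 0) : lift 0 (Sum A B)"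
    using var[OF ctx_Cons[OF A], of 0] lift_type[OF A B] by (simp add: Sum_introL)
  from type_Pi[OF A inst_type[OF weaken_motive1[OF assms(2) A] this]]
  show "\<Gamma> \<turnstile> Pi A (inst_under1 C (InL (Var 0))) type" by simp
  have "B # \<Gamma> \<turnstile> InR (Var 0) : lift 0 (Sum A B)"
    using var[OF ctx_Cons[OF B], of 0] lift_type[OF B A] by (simp add: Sum_introR)
  from type_Pi[OF B inst_type[OF weaken_motive1[OF assms(2) B] this]]
  show "\<Gamma> \<turnstile> Pi B (inst_under1 C (InR (Var 0))) type" by simp
qed

lemma NatElim_step_type:
  assumes "Nat # \<Gamma> \<turnstile> C type"
  shows "\<Gamma> \<turnstile> Pi Nat (Pi C (inst_under2 C (Succ (Var 1)))) type"
proof -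
  from ctx_Cons[OF assms] have \<Gamma>: "ctx (C # Nat # \<Gamma>)" .
  have "C # Nat # \<Gamma> \<turnstile> Succ (Var (Suc 0)) : lift 0 (lift 0 Nat)"
    using var[OF \<Gamma>, of 1] by (simp add: Nat_introS)
  from inst_type[OF weaken_motive2[OF assms assms] this] assms show ?thesis
    using type_ctx[OF assms] by (auto intro: type_Pi elim: ctx.cases)
qed

lemma funext_type:
  assumes "\<Gamma> \<turnstile> Eq (Pi A B) f g type"
  shows "\<Gamma> \<turnstile> Pi A (Eq B (App (lift 0 f) (Var 0)) (App (lift 0 g) (Var 0))) type"
proof -
  from Eq_type_inversion[OF assms] have F: "\<Gamma> \<turnstile> Pi A B type" "\<Gamma> \<turnstile> f : Pi A B" "\<Gamma> \<turnstile> g : Pi A B" by auto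
  then have A: "\<Gamma> \<turnstile> A type" and B: "A # \<Gamma> \<turnstile> B type" by (auto dest: Pi_type_inversion)
  have "A # \<Gamma> \<turnstile> App (lift 0 h) (Var 0) : B" if "\<Gamma> \<turnstile> h : Pi A B" for h
    using Pi_elim[of "A # \<Gamma>" "lift 0 h" "lift 0 A" "lift (Suc 0) B" "Var 0"]
      lift_term[OF A that] var[OF ctx_Cons[OF A], of 0] inst_Var_lift[of 0 B] by simp
  with A B F show ?thesis by (blast intro: type_Pi type_Eq)
qed

text \<open>Weaken \<open>B\<close> by a variable of type \<open>A\<close>, then instantiate the old
  variable by the new one, retyped to \<open>A'\<close> by conversion.\<close>

lemma context_conversion:
  assumes "A' # \<Gamma> \<turnstile> B type" "\<Gamma> \<turnstile> A type" "A \<approx> A'"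
  shows "A # \<Gamma> \<turnstile> B type"
proof -
  have A': "\<Gamma> \<turnstile> A' type" using type_ctx[OF assms(1)] by (auto elim: ctx.cases)
  have "A # \<Gamma> \<turnstile> Var 0 : lift 0 A'"
    using conversion[OF _ lift_type[OF assms(2) A'] conv_lift[OF assms(3)]] var[OF ctx_Cons[OF assms(2)], of 0]
    by simp
  from inst_type[OF weaken_motive1[OF assms(1,2)] this] show ?thesis by (simp add: inst_Var_lift)
qed

text \<open>The presuppositions of a query are hypotheses of its meaning: a well-formed context for
  \<open>Infer\<close> and \<open>CheckType\<close>, a well-formed type for
  \<open>Check\<close>.\<close>

primrec valid :: "query \<Rightarrow> tm \<Rightarrow> bool" where
  "valid (Infer \<Gamma> t) A = (ctx \<Gamma> \<longrightarrow> \<Gamma> \<turnstile> t : A)"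
| "valid (Check \<Gamma> t T) A = (\<Gamma> \<turnstile> T type \<longrightarrow> \<Gamma> \<turnstile> t : T)"
| "valid (CheckType \<Gamma> T) A = (ctx \<Gamma> \<longrightarrow> \<Gamma> \<turnstile> T type)"
| "valid (Conv t u) A = (t \<approx> u)"

lemma keep_Some: "keep x y = Some z \<longleftrightarrow> x \<noteq> None \<and> y = Some z"
  by (cases x) auto

lemma Some_keep: "Some z = keep x y \<longleftrightarrow> x \<noteq> None \<and> y = Some z"
  by (cases x) auto

lemma if_true_Some: "if_true b T = Some T' \<longleftrightarrow> b \<and> T' = T"
  by (cases b) auto

lemma lookup_Some: "lookup m \<Gamma> i = Some A \<Longrightarrow> i < length \<Gamma> \<and> A = (lift 0 ^^ (m + i)) (\<Gamma> ! i)"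
  by (induction m \<Gamma> i rule: lookup.induct) (auto simp: shift_funpow)

text \<open>One layer of the checker is analysed over an arbitrary sound oracle \<open>R\<close>;
  induction on fuel in \<open>answer_sound\<close> then supplies the oracle.\<close>

context
  fixes R :: "query \<Rightarrow> tm option"
  assumes R: "\<And>q r. R q = Some r \<Longrightarrow> valid q r"
begin

lemma R_Infer: "R (Infer \<Gamma> t) = Some A \<Longrightarrow> ctx \<Gamma> \<Longrightarrow> \<Gamma> \<turnstile> t : A"
  and R_Check: "R (Check \<Gamma> t T) \<noteq> None \<Longrightarrow> \<Gamma> \<turnstile> T type \<Longrightarrow> \<Gamma> \<turnstile> t : T"
  and R_CheckType: "R (CheckType \<Gamma> T) \<noteq> None \<Longrightarrow> ctx \<Gamma> \<Longrightarrow> \<Gamma> \<turnstile> T type"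
  and R_Conv: "R (Conv t u) \<noteq> None \<Longrightarrow> t \<approx> u"
  using R by fastforce+

lemma expose_sound:
  assumes "expose R (whnf n) \<Gamma> T = Some T'" "\<Gamma> \<turnstile> T type"
  shows "\<Gamma> \<turnstile> T' type \<and> T \<approx> T'"
proof -
  have "T' = T \<or> recheck R \<Gamma> (whnf n T) = Some T'"
    using assms(1) by (auto elim!: expose.elims)
  then show ?thesis
    using assms(2) type_ctx[OF assms(2)]
    by (auto simp: recheck_def keep_Some Some_keep conv.refl whnf_conv intro: R_CheckType)
qed

lemma expose_opt_sound:
  assumes "expose_opt R (whnf n) \<Gamma> (R (Infer \<Gamma> t)) = Some T" "ctx \<Gamma>"
  shows "\<Gamma> \<turnstile> t : T"
proof -
  from assms obtain A where A: "R (Infer \<Gamma> t) = Some A" and e: "expose R (whnf n) \<Gamma> A = Some T"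
    by (cases "R (Infer \<Gamma> t)") auto
  from R_Infer[OF A assms(2)] have t: "\<Gamma> \<turnstile> t : A" .
  from expose_sound[OF e validity[OF t]] show ?thesis by (blast intro: conversion t)
qed

lemma infer_step_sound:
  assumes "infer_step R (whnf n) \<Gamma> t = Some T" "ctx \<Gamma>"
  shows "\<Gamma> \<turnstile> t : T"
proof (cases t)
  case (Pi A B)
  with assms have "R (Check \<Gamma> A Univ) \<noteq> None" "R (Check (A # \<Gamma>) B Univ) \<noteq> None" and T: "T = Univ"
    by (auto simp: keep_Some Some_keep)
  moreover from this have A: "\<Gamma> \<turnstile> A : Univ" using assms(2) by (blast intro: R_Check type_Univ)
  ultimately show ?thesis
    unfolding Pi T by (blast intro: univ_Pi R_Check type_Univ ctx_Cons type_El)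
next
  case (Sig A B)
  with assms have "R (Check \<Gamma> A Univ) \<noteq> None" "R (Check (A # \<Gamma>) B Univ) \<noteq> None" and T: "T = Univ"
    by (auto simp: keep_Some Some_keep)
  moreover from this have A: "\<Gamma> \<turnstile> A : Univ" using assms(2) by (blast intro: R_Check type_Univ)
  ultimately show ?thesis
    unfolding Sig T by (blast intro: univ_Sig R_Check type_Univ ctx_Cons type_El)
next
  case (Var i)
  with assms show ?thesis using lookup_Some[of 1 \<Gamma> i T] var[of \<Gamma> i] by simp
next
  case (Sum A B)
  with assms show ?thesis by (auto simp: keep_Some Some_keep intro!: univ_Sum intro: R_Check type_Univ)
next
  case (Eq A a b)
  with assms have A: "\<Gamma> \<turnstile> A : Univ" by (auto simp: keep_Some Some_keep intro: R_Check type_Univ)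
  with assms Eq show ?thesis by (auto simp: keep_Some Some_keep intro!: univ_Eq intro: R_Check type_El)
next
  case (Trunc A)
  with assms show ?thesis by (auto simp: keep_Some Some_keep intro!: univ_Trunc intro: R_Check type_Univ)
next
  case (Lam A b)
  with assms obtain B where "R (CheckType \<Gamma> A) \<noteq> None" "R (Infer (A # \<Gamma>) b) = Some B" "T = Pi A B"
    by (auto simp: keep_Some elim: infer_Lam.elims)
  with assms(2) Lam show ?thesis by (blast intro: Pi_intro R_CheckType R_Infer ctx_Cons)
next
  case (App f a)
  with assms obtain A B where f: "expose_opt R (whnf n) \<Gamma> (R (Infer \<Gamma> f)) = Some (Pi A B)"
    and a: "R (Check \<Gamma> a A) \<noteq> None" and T: "T = inst B a"
    by (auto simp: keep_Some Some_keep elim!: infer_App.elims)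
  have f: "\<Gamma> \<turnstile> f : Pi A B" using expose_opt_sound[OF f assms(2)] .
  have "\<Gamma> \<turnstile> a : A" using R_Check[OF a] Pi_type_inversion[OF validity[OF f]] by blast
  with f show ?thesis unfolding App T by (rule Pi_elim)
next
  case (Split C d p)
  with assms obtain A B where p: "expose_opt R (whnf n) \<Gamma> (R (Infer \<Gamma> p)) = Some (Sig A B)"
    and C: "R (CheckType (Sig A B # \<Gamma>) C) \<noteq> None"
    and d: "R (Check \<Gamma> d (Pi A (Pi B (inst_under2 C (Pair (Var 1) (Var 0)))))) \<noteq> None"
    and T: "T = inst C p"
    by (auto simp: keep_Some Some_keep elim!: infer_Split.elims)
  have p: "\<Gamma> \<turnstile> p : Sig A B" using expose_opt_sound[OF p assms(2)] .
  have C: "Sig A B # \<Gamma> \<turnstile> C type" using R_CheckType[OF C ctx_Cons[OF validity[OF p]]] .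
  from Sig_elim[OF C R_Check[OF d Split_branch_type[OF validity[OF p] C]] p]
  show ?thesis unfolding Split T .
next
  case (Case C l r s)
  with assms obtain A B where s: "expose_opt R (whnf n) \<Gamma> (R (Infer \<Gamma> s)) = Some (Sum A B)"
    and C: "R (CheckType (Sum A B # \<Gamma>) C) \<noteq> None"
    and l: "R (Check \<Gamma> l (Pi A (inst_under1 C (InL (Var 0))))) \<noteq> None"
    and r: "R (Check \<Gamma> r (Pi B (inst_under1 C (InR (Var 0))))) \<noteq> None"
    and T: "T = inst C s"
    by (auto simp: keep_Some Some_keep elim!: infer_Case.elims)
  have s: "\<Gamma> \<turnstile> s : Sum A B" using expose_opt_sound[OF s assms(2)] .
  have C: "Sum A B # \<Gamma> \<turnstile> C type" using R_CheckType[OF C ctx_Cons[OF validity[OF s]]] .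
  note branches = Case_branch_type[OF validity[OF s] C]
  from Sum_elim[OF C R_Check[OF l branches(1)] R_Check[OF r branches(2)] s]
  show ?thesis unfolding Case T .
next
  case (Absurd C s)
  with assms show ?thesis
    by (auto simp: keep_Some Some_keep intro!: Empty_elim intro: R_Check R_CheckType type_El univ_Empty)
next
  case (UnitElim C c s)
  with assms have "R (Check \<Gamma> s Unit) \<noteq> None" "R (CheckType (Unit # \<Gamma>) C) \<noteq> None"
    and c: "R (Check \<Gamma> c (inst C Star)) \<noteq> None" and T: "T = inst C s"
    by (auto simp: keep_Some Some_keep)
  with assms(2) have s: "\<Gamma> \<turnstile> s : Unit" and C: "Unit # \<Gamma> \<turnstile> C type"
    by (blast intro: R_Check R_CheckType ctx_Cons type_El univ_Unit)+
  from Unit_elim[OF C R_Check[OF c inst_type[OF C Unit_intro[OF assms(2)]]] s]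
  show ?thesis unfolding UnitElim T .
next
  case (TwoElim C a b s)
  with assms have "R (Check \<Gamma> s Two) \<noteq> None" "R (CheckType (Two # \<Gamma>) C) \<noteq> None"
    and a: "R (Check \<Gamma> a (inst C Two0)) \<noteq> None" and b: "R (Check \<Gamma> b (inst C Two1)) \<noteq> None"
    and T: "T = inst C s"
    by (auto simp: keep_Some Some_keep)
  with assms(2) have s: "\<Gamma> \<turnstile> s : Two" and C: "Two # \<Gamma> \<turnstile> C type"
    by (blast intro: R_Check R_CheckType ctx_Cons type_El univ_Two)+
  from Two_elim[OF C R_Check[OF a inst_type[OF C Two_intro0[OF assms(2)]]]
      R_Check[OF b inst_type[OF C Two_intro1[OF assms(2)]]] s]
  show ?thesis unfolding TwoElim T .
next
  case (NatElim C z s m)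
  with assms have "R (Check \<Gamma> m Nat) \<noteq> None" "R (CheckType (Nat # \<Gamma>) C) \<noteq> None"
    and z: "R (Check \<Gamma> z (inst C Zero)) \<noteq> None"
    and s: "R (Check \<Gamma> s (Pi Nat (Pi C (inst_under2 C (Succ (Var 1)))))) \<noteq> None"
    and T: "T = inst C m"
    by (auto simp: keep_Some Some_keep)
  with assms(2) have m: "\<Gamma> \<turnstile> m : Nat" and C: "Nat # \<Gamma> \<turnstile> C type"
    by (blast intro: R_Check R_CheckType ctx_Cons type_El univ_Nat)+
  from Nat_elim[OF C R_Check[OF z inst_type[OF C Nat_intro0[OF assms(2)]]]
      R_Check[OF s NatElim_step_type[OF C]] m]
  show ?thesis unfolding NatElim T .
next
  case (Succ m)
  with assms show ?thesis
    by (auto simp: keep_Some Some_keep intro!: Nat_introS intro: R_Check type_El univ_Nat)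
next
  case (Refl a)
  with assms show ?thesis by (auto elim!: infer_Refl.elims intro: Eq_intro R_Infer)
next
  case (J C d p)
  with assms obtain A a b where p: "expose_opt R (whnf n) \<Gamma> (R (Infer \<Gamma> p)) = Some (Eq A a b)"
    and C: "R (CheckType (Eq (lift 0 A) (lift 0 a) (Var 0) # A # \<Gamma>) C) \<noteq> None"
    and d: "R (Check \<Gamma> d (inst2 C a (Refl a))) \<noteq> None"
    and T: "T = inst2 C b p"
    by (auto simp: keep_Some Some_keep elim!: infer_J.elims)
  have p: "\<Gamma> \<turnstile> p : Eq A a b" using expose_opt_sound[OF p assms(2)] .
  from Eq_type_inversion[OF validity[OF p]] have A: "\<Gamma> \<turnstile> A type" and a: "\<Gamma> \<turnstile> a : A" by auto
  have "A # \<Gamma> \<turnstile> Eq (lift 0 A) (lift 0 a) (Var 0) type"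
    using var[OF ctx_Cons[OF A], of 0] lift_type[OF A A] lift_term[OF A a] by (simp add: type_Eq)
  from R_CheckType[OF C ctx_Cons[OF this]]
  have C: "Eq (lift 0 A) (lift 0 a) (Var 0) # A # \<Gamma> \<turnstile> C type" .
  from Eq_elim[OF C R_Check[OF d inst2_type[OF C a Eq_intro[OF a]]] p] show ?thesis
    unfolding J T .
next
  case (TruncIn a)
  with assms show ?thesis by (auto elim!: infer_TruncIn.elims intro: Trunc_intro R_Infer)
next
  case (TruncProp A)
  with assms have "R (CheckType \<Gamma> (Trunc A)) \<noteq> None" and T: "T = IsProp (Trunc A)"
    by (auto simp: keep_Some Some_keep)
  with assms(2) show ?thesis
    unfolding TruncProp T by (blast intro: Trunc_prop R_CheckType Trunc_type_inversion)
next
  case (TruncElim h f s)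
  with assms obtain A X where h: "R (Infer \<Gamma> h) = Some (Pi T X)" and X: "R (Conv (Pi T X) (IsProp T)) \<noteq> None"
    and s: "expose_opt R (whnf n) \<Gamma> (R (Infer \<Gamma> s)) = Some (Trunc A)"
    and f: "R (Check \<Gamma> f (Arr A T)) \<noteq> None"
    by (auto simp: keep_Some Some_keep elim!: infer_TruncElim.elims infer_TruncElim_arg.elims[OF HOL.sym])
  have h: "\<Gamma> \<turnstile> h : Pi T X" using R_Infer[OF h assms(2)] .
  have s: "\<Gamma> \<turnstile> s : Trunc A" using expose_opt_sound[OF s assms(2)] .
  \<comment> \<open>\<open>T\<close> was only read off from the type of \<open>h\<close>, so
    validity and inversion have to certify it.\<close>
  have T: "\<Gamma> \<turnstile> T type" using Pi_type_inversion[OF validity[OF h]] by blast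
  have "\<Gamma> \<turnstile> h : IsProp T" using conversion[OF h IsProp_type[OF T] R_Conv[OF X]] .
  from Trunc_elim[OF T this R_Check[OF f Arr_type[OF Trunc_type_inversion[OF validity[OF s]] T]] s]
  show ?thesis unfolding TruncElim .
qed (use assms in \<open>auto intro: typing_rules\<close>)

lemma convert_sound:
  assumes "convert R T (R (Infer \<Gamma> t)) = Some A" "\<Gamma> \<turnstile> T type"
  shows "\<Gamma> \<turnstile> t : T"
proof -
  from assms obtain B where B: "R (Infer \<Gamma> t) = Some B" and c: "R (Conv B T) \<noteq> None"
    by (auto simp: keep_Some Some_keep elim!: convert.elims)
  from conversion[OF R_Infer[OF B type_ctx[OF assms(2)]] assms(2) R_Conv[OF c]] show ?thesis .
qed

lemma check_step_sound:
  assumes "check_step R (whnf n) \<Gamma> t T = Some r" "\<Gamma> \<turnstile> T type"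
  shows "\<Gamma> \<turnstile> t : T"
proof -
  have convd: "\<Gamma> \<turnstile> t : T" if "\<Gamma> \<turnstile> t : S" "T \<approx> S" for S
    using that assms(2) by (blast intro: conversion conv.sym)
  show ?thesis
  proof (cases t)
    case (Lam A b)
    with assms obtain A' B where e: "expose R (whnf n) \<Gamma> T = Some (Pi A' B)"
      and c: "check_Lam_body R \<Gamma> A b A' B (A = A') = Some r"
      by (auto elim!: check_Lam.elims dest!: HOL.sym[of "Some r"])
    from expose_sound[OF e assms(2)] have F: "\<Gamma> \<turnstile> Pi A' B type" "T \<approx> Pi A' B" by auto
    from Pi_type_inversion[OF F(1)] have A': "\<Gamma> \<turnstile> A' type" and B: "A' # \<Gamma> \<turnstile> B type" by auto
    have "\<Gamma> \<turnstile> A type \<and> A \<approx> A' \<and> R (Check (A # \<Gamma>) b B) \<noteq> None"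
    proof (cases "A = A'")
      case True
      with c A' show ?thesis by (auto intro: conv.refl)
    next
      case False
      with c type_ctx[OF assms(2)] show ?thesis
        by (auto simp: keep_Some intro: R_CheckType R_Conv)
    qed
    then have A: "\<Gamma> \<turnstile> A type" "A \<approx> A'" and b: "R (Check (A # \<Gamma>) b B) \<noteq> None" by auto
    from Pi_intro[OF A(1) R_Check[OF b context_conversion[OF B A]]] have "\<Gamma> \<turnstile> Lam A b : Pi A B" .
    moreover have "T \<approx> Pi A B" using F(2) A(2) by (blast intro: conv.trans cong_Pi conv.sym conv.refl)
    ultimately show ?thesis using convd Lam by blast
  next
    case (Pair a b)
    with assms obtain A B where e: "expose R (whnf n) \<Gamma> T = Some (Sig A B)"
      and a: "R (Check \<Gamma> a A) \<noteq> None" and b: "R (Check \<Gamma> b (inst B a)) \<noteq> None"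
      by (auto simp: keep_Some Some_keep elim!: check_Pair.elims)
    from expose_sound[OF e assms(2)] have S: "\<Gamma> \<turnstile> Sig A B type" "T \<approx> Sig A B" by auto
    from Sig_type_inversion[OF S(1)] have A: "\<Gamma> \<turnstile> A type" and B: "A # \<Gamma> \<turnstile> B type" by auto
    have a: "\<Gamma> \<turnstile> a : A" using R_Check[OF a A] .
    from Sig_intro[OF B a R_Check[OF b inst_type[OF B a]]] have "\<Gamma> \<turnstile> Pair a b : Sig A B" .
    then show ?thesis using convd S(2) Pair by blast
  next
    case (InL a)
    with assms obtain A B where e: "expose R (whnf n) \<Gamma> T = Some (Sum A B)"
      and a: "R (Check \<Gamma> a A) \<noteq> None"
      by (auto simp: keep_Some Some_keep elim!: check_InL.elims dest!: HOL.sym[of "Some r"])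
    from expose_sound[OF e assms(2)] have S: "\<Gamma> \<turnstile> Sum A B type" "T \<approx> Sum A B" by auto
    from Sum_type_inversion[OF S(1)] a have "\<Gamma> \<turnstile> InL a : Sum A B" by (blast intro: Sum_introL R_Check)
    then show ?thesis using convd S(2) InL by blast
  next
    case (InR b)
    with assms obtain A B where e: "expose R (whnf n) \<Gamma> T = Some (Sum A B)"
      and b: "R (Check \<Gamma> b B) \<noteq> None"
      by (auto simp: keep_Some Some_keep elim!: check_InR.elims dest!: HOL.sym[of "Some r"])
    from expose_sound[OF e assms(2)] have S: "\<Gamma> \<turnstile> Sum A B type" "T \<approx> Sum A B" by auto
    from Sum_type_inversion[OF S(1)] b have "\<Gamma> \<turnstile> InR b : Sum A B" by (blast intro: Sum_introR R_Check)
    then show ?thesis using convd S(2) InR by blast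
  next
    case (TruncIn a)
    with assms obtain A where e: "expose R (whnf n) \<Gamma> T = Some (Trunc A)"
      and a: "R (Check \<Gamma> a A) \<noteq> None"
      by (auto simp: keep_Some Some_keep elim!: check_TruncIn.elims dest!: HOL.sym[of "Some r"])
    from expose_sound[OF e assms(2)] have S: "\<Gamma> \<turnstile> Trunc A type" "T \<approx> Trunc A" by auto
    from Trunc_type_inversion[OF S(1)] a have "\<Gamma> \<turnstile> TruncIn a : Trunc A" by (blast intro: Trunc_intro R_Check)
    then show ?thesis using convd S(2) TruncIn by blast
  next
    case (Refl a)
    with assms obtain A x y where e: "expose R (whnf n) \<Gamma> T = Some (Eq A x y)"
      and a: "R (Check \<Gamma> a A) \<noteq> None" and x: "R (Conv a x) \<noteq> None" and y: "R (Conv a y) \<noteq> None"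
      by (auto simp: keep_Some Some_keep elim!: check_Refl.elims)
    from expose_sound[OF e assms(2)] have S: "\<Gamma> \<turnstile> Eq A x y type" "T \<approx> Eq A x y" by auto
    from Eq_type_inversion[OF S(1)] a have "\<Gamma> \<turnstile> Refl a : Eq A a a" by (blast intro: Eq_intro R_Check)
    moreover have "Eq A a a \<approx> Eq A x y" using x y by (blast intro: cong_Eq conv.refl R_Conv)
    ultimately have "\<Gamma> \<turnstile> Refl a : Eq A x y" using S(1) by (blast intro: conversion)
    then show ?thesis using convd S(2) Refl by blast
  next
    case (FunExt h)
    with assms obtain A B f g where e: "expose R (whnf n) \<Gamma> T = Some (Eq (Pi A B) f g)"
      and h: "R (Check \<Gamma> h (Pi A (Eq B (App (lift 0 f) (Var 0)) (App (lift 0 g) (Var 0))))) \<noteq> None"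
      by (auto simp: keep_Some Some_keep elim!: check_FunExt.elims check_FunExt_at.elims dest!: HOL.sym[of "Some r"])
    from expose_sound[OF e assms(2)] have S: "\<Gamma> \<turnstile> Eq (Pi A B) f g type" "T \<approx> Eq (Pi A B) f g" by auto
    from R_Check[OF h funext_type[OF S(1)]] Eq_type_inversion[OF S(1)]
    have "\<Gamma> \<turnstile> FunExt h : Eq (Pi A B) f g" by (blast intro: funext)
    then show ?thesis using convd S(2) FunExt by blast
  next
    case (PropExt p q f g)
    with assms obtain U P Q where e: "expose R (whnf n) \<Gamma> T = Some (Eq U P Q)"
      and U: "R (Conv U Univ) \<noteq> None"
      and p: "R (Check \<Gamma> p (IsProp P)) \<noteq> None" and q: "R (Check \<Gamma> q (IsProp Q)) \<noteq> None"
      and f: "R (Check \<Gamma> f (Arr P Q)) \<noteq> None" and g: "R (Check \<Gamma> g (Arr Q P)) \<noteq> None"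
      by (auto simp: keep_Some Some_keep elim!: check_PropExt.elims)
    from expose_sound[OF e assms(2)] have S: "\<Gamma> \<turnstile> Eq U P Q type" "T \<approx> Eq U P Q" by auto
    have univ: "\<Gamma> \<turnstile> Univ type" using type_Univ[OF type_ctx[OF assms(2)]] .
    with Eq_type_inversion[OF S(1)] R_Conv[OF U] have P: "\<Gamma> \<turnstile> P : Univ" and Q: "\<Gamma> \<turnstile> Q : Univ"
      by (blast intro: conversion)+
    note P' = type_El[OF P] and Q' = type_El[OF Q]
    from propext[OF P Q R_Check[OF p IsProp_type[OF P']] R_Check[OF q IsProp_type[OF Q']]
        R_Check[OF f Arr_type[OF P' Q']] R_Check[OF g Arr_type[OF Q' P']]]
    have "\<Gamma> \<turnstile> PropExt p q f g : Eq Univ P Q" .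
    \<comment> \<open>\<open>U\<close> is merely convertible to \<open>Univ\<close>: the endpoints
      were retyped in order to apply the rule, and its conclusion is converted back.\<close>
    from conversion[OF this S(1) cong_Eq[OF conv.sym[OF R_Conv[OF U]] conv.refl conv.refl]]
    have "\<Gamma> \<turnstile> PropExt p q f g : Eq U P Q" .
    then show ?thesis using convd S(2) PropExt by blast
  qed (use assms convert_sound in auto)
qed

lemma check_type_step_sound:
  assumes "check_type_step K R \<Gamma> T = Some r" "ctx \<Gamma>" and K: "K \<Gamma> \<le> is_type \<Gamma>"
  shows "\<Gamma> \<turnstile> T type"
proof (cases T)
  case (Pi A B)
  with assms have "R (CheckType \<Gamma> A) \<noteq> None" "R (CheckType (A # \<Gamma>) B) \<noteq> None"
    by (auto simp: keep_Some Some_keep)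
  with assms(2) Pi show ?thesis by (blast intro: type_Pi R_CheckType ctx_Cons)
next
  case (Sig A B)
  with assms have "R (CheckType \<Gamma> A) \<noteq> None" "R (CheckType (A # \<Gamma>) B) \<noteq> None"
    by (auto simp: keep_Some Some_keep)
  with assms(2) Sig show ?thesis by (blast intro: type_Sig R_CheckType ctx_Cons)
next
  case (Sum A B)
  with assms show ?thesis by (auto simp: keep_Some Some_keep intro!: type_Sum intro: R_CheckType)
next
  case (Eq A a b)
  with assms have A: "\<Gamma> \<turnstile> A type" by (auto simp: keep_Some Some_keep intro: R_CheckType)
  with assms Eq show ?thesis by (auto simp: keep_Some Some_keep intro!: type_Eq intro: R_Check)
next
  case (Trunc A)
  with assms have "K \<Gamma> A \<or> R (CheckType \<Gamma> A) \<noteq> None" by (cases "K \<Gamma> A") auto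
  with K assms(2) Trunc show ?thesis by (auto intro!: type_Trunc intro: R_CheckType)
qed (use assms in \<open>auto intro: type_El R_Check type_Univ\<close>)

end

lemma answer_sound:
  assumes "\<And>\<Gamma>. ctx \<Gamma> \<Longrightarrow> K \<Gamma> \<le> is_type \<Gamma>"
  shows "answer K n q = Some r \<Longrightarrow> valid q r"
proof (induction n arbitrary: q r)
  case (Suc n)
  show ?case
  proof (cases q)
    case (Infer \<Gamma> t)
    with Suc.prems infer_step_sound[OF Suc.IH] show ?thesis by auto
  next
    case (Check \<Gamma> t T)
    with Suc.prems check_step_sound[OF Suc.IH] show ?thesis by auto
  next
    case (CheckType \<Gamma> T)
    with Suc.prems check_type_step_sound[OF Suc.IH] assms show ?thesis by auto
  next
    case (Conv t u)
    with Suc.prems show ?thesis by (auto simp: if_true_Some intro: conv_check_sound)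
  qed
qed simp


section \<open>Evaluating the checker\<close>

abbreviation nothing_known :: "tm list \<Rightarrow> tm \<Rightarrow> bool" where
  "nothing_known \<equiv> \<lambda>_ _. False"

lemma nothing_known_sound: "answer nothing_known n q = Some r \<Longrightarrow> valid q r"
  by (rule answer_sound[of nothing_known]) auto

lemma infer_typed: "answer nothing_known n (Infer \<Gamma> t) = Some A \<Longrightarrow> ctx \<Gamma> \<Longrightarrow> \<Gamma> \<turnstile> t : A"
  by (drule nothing_known_sound) simp

lemma check_typed: "answer nothing_known n (Check \<Gamma> t T) \<noteq> None \<Longrightarrow> \<Gamma> \<turnstile> T type \<Longrightarrow> \<Gamma> \<turnstile> t : T"
  by (auto dest: nothing_known_sound)

lemma check_type_typed: "answer nothing_known n (CheckType \<Gamma> T) \<noteq> None \<Longrightarrow> ctx \<Gamma> \<Longrightarrow> \<Gamma> \<turnstile> T type"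
  by (auto dest: nothing_known_sound)

text \<open>Fuel bounds the depth of the recursion, not the number of steps; eighty levels suffice
  for the evaluations below.\<close>

abbreviation (input) ten_more :: "nat \<Rightarrow> nat" where
  "ten_more n \<equiv> Suc (Suc (Suc (Suc (Suc (Suc (Suc (Suc (Suc (Suc n)))))))))"

text \<open>Written with \<open>Suc\<close>, so that the equations of the checker apply.\<close>

abbreviation (input) fuel :: nat where
  "fuel \<equiv> ten_more (ten_more (ten_more (ten_more (ten_more (ten_more (ten_more (ten_more 0)))))))"

lemmas index_simps = Suc_less_eq zero_less_Suc not_less_zero if_True if_False
  nat.inject nat.distinct simp_thms diff_Suc_Suc diff_zero One_nat_def

lemmas checker_simps = answer.simps answer_step.simps check_type_step.simps check_unless_known.simps
  check_step.simps check_Lam.simps check_Lam_body.simps check_Pair.simps check_InL.simps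
  check_InR.simps check_Refl.simps check_TruncIn.simps check_FunExt.simps check_FunExt_at.simps
  check_PropExt.simps convert.simps infer_step.simps infer_Lam.simps infer_App.simps
  infer_Split.simps infer_Case.simps infer_Refl.simps infer_J.simps infer_TruncIn.simps
  infer_TruncElim.simps infer_TruncElim_arg.simps expose.simps expose_opt.simps recheck_def
  lookup.simps if_true.simps all_ok.simps keep.simps conv_check.simps conv_step.simps
  conv_whnf_def conv_children.simps head.simps children.simps whnf.simps whnf_step.simps
  app_redex.simps split_redex.simps case_redex.simps unit_redex.simps two_redex.simps
  nat_redex.simps J_redex.simps shift.simps lift.simps subst.simps IsProp_def
  list.rel_inject list.rel_distinct tm.inject tm.distinct option.distinct add_Suc add_0 diff_Suc_1
  index_simps

lemmas otm_defs = bv_def univ_def pi_def lam_def app_def sig_def pair_def sig_elim_def sum_type_def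
  inl_def inr_def sum_elim_def empty_def absurd_def unit_def star_def unit_elim_def two_def two0_def
  two1_def two_elim_def nat_type_def zero_def succ_def nat_elim_def eq_def rfl_def eq_elim_def
  trunc_def trunc_prop_def trunc_elim_def arr_def prod_type_def proj1_def proj2_def is_prop_def
  is_equiv_def equiv_type_def transport_def Let_def numeral_2_eq_2 diff_Suc_Suc diff_zero One_nat_def

text \<open>
  In a context of length \<open>n + m\<close> with \<open>m\<close> concrete, these rules cancel the offset \<open>n\<close> in every
  index, so the unfolding of a closed term shows that it does not depend on \<open>n\<close>.
\<close>

lemma offset_simps: "Suc (n + m) = n + Suc m" "(n + m) - (n + l) = m - l" for n m l :: nat
  by simp_all


section \<open>Computability\<close>

text \<open>
  Unfolded, the type of computability proofs is too large to be checked repeatedly. It is checked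
  once and then treated as an opaque family of types that commutes with lifting and substitution.
\<close>

lemmas machine_defs = machine_def machine_init_def machine_step_def primrec_fun_def primrec_type_def
  is_primrec_def primrec_closed_def tuple_cons_def tuple_tl_def tuple_hd_def tuple_def fin_def

lemmas extent_defs = extent_def halts_with_def run_def step_def decode_def state_def add_def
  succ_cong_def add_zero_def add_succ_def add_comm_def obs_def obs_refl_def obs_induct_def
  unit_is_prop_def empty_is_prop_def obs_is_prop_def obs_to_eq_def run_stays_def run_agree_def
  halts_agree_def value_unique_def extent_is_prop_def lifting_def eta_def two_to_nat_def

text \<open>In \<open>eval\<close> the two functions of the machine recur many times as nested
  projections. Abstracting them allows the body to be checked with variables in their place.\<close>

definition eval_at :: "otm \<Rightarrow> otm \<Rightarrow> otm \<Rightarrow> otm" where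
  "eval_at i s x = pair (extent i s x) (pair (extent_is_prop \<cdot> i \<cdot> s \<cdot> x)
     (lam (extent i s x) (\<lambda>e. proj1 nat_type (\<lambda>y. trunc (halts_with i s x y)) e)))"

lemma eval_eq: "eval m = lam nat_type (eval_at (machine_init m) (machine_step m))"
  by (simp add: eval_def eval_at_def[abs_def] Let_def)

lemma machine_index: "machine n = machine 0"
proof -
  have "machine (n + 0) = machine 0" by (simp only: machine_defs otm_defs offset_simps)
  then show ?thesis by simp
qed

lemma lifting_index: "lifting nat_type n = lifting nat_type 0"
proof -
  have "lifting nat_type (n + 0) = lifting nat_type 0"
    by (simp only: lifting_def otm_defs offset_simps)
  then show ?thesis by simp
qed

lemma eval_index: "eval (bv n) (Suc n) = eval (bv 0) (Suc 0)"
proof -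
  have "eval (bv (n + 0)) (n + Suc 0) = eval (bv 0) (Suc 0)"
    by (simp only: eval_eq eval_at_def machine_defs extent_defs otm_defs offset_simps)
  then show ?thesis by simp
qed

lemma machine_fun_lift:
  assumes "m (Suc n) = lift 0 (m n)"
  shows "machine_init m (Suc n) = lift 0 (machine_init m n)"
    and "machine_step m (Suc n) = lift 0 (machine_step m n)"
proof -
  have m: "m (n + Suc 0) = lift 0 (m (n + 0))" using assms by simp
  have "machine_init m (n + Suc 0) = lift 0 (machine_init m (n + 0))"
    by (simp only: machine_defs otm_defs offset_simps m) (simp only: lift.simps index_simps)
  then show "machine_init m (Suc n) = lift 0 (machine_init m n)" by simp
  have "machine_step m (n + Suc 0) = lift 0 (machine_step m (n + 0))"
    by (simp only: machine_defs otm_defs offset_simps m) (simp only: lift.simps index_simps)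
  then show "machine_step m (Suc n) = lift 0 (machine_step m n)" by simp
qed

abbreviation eval_body :: tm where
  "eval_body \<equiv> eval_at (bv 0) (bv 1) (bv 2) (Suc (Suc (Suc 0)))"

text \<open>\<open>eval_body\<close> lives over \<open>i\<close>, \<open>s\<close>,
  \<open>x\<close>. The lift at 3 makes room for one ambient variable outermost; then index 2
  receives the given \<open>i\<close> and index 1 the given \<open>s\<close>.\<close>

lemma eval_at_subst:
  assumes "\<And>k. i (Suc (Suc k)) = lift 0 (i (Suc k))" "\<And>k. s (Suc (Suc k)) = lift 0 (s (Suc k))"
  shows "eval_at i s (bv (Suc 0)) (Suc (Suc 0)) =
    subst (Suc 0) (lift 0 (s (Suc 0)))
      (subst (Suc (Suc 0)) (lift 0 (lift 0 (i (Suc 0)))) (lift (Suc (Suc (Suc 0))) eval_body))"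
  by (simp only: eval_at_def extent_defs otm_defs assms)
    (simp only: lift.simps subst.simps index_simps subst_lift_le[OF le0] subst_lift)

lemma eval_subst:
  "eval (bv 0) (Suc 0) = Lam Nat (subst (Suc 0) (lift 0 (machine_step (bv 0) (Suc 0)))
    (subst (Suc (Suc 0)) (lift 0 (lift 0 (machine_init (bv 0) (Suc 0))))
      (lift (Suc (Suc (Suc 0))) eval_body)))"
proof -
  have "bv 0 (Suc (Suc k)) = lift 0 (bv 0 (Suc k))" for k by (simp add: bv_def)
  from eval_at_subst[of "machine_init (bv 0)" "machine_step (bv 0)",
      OF machine_fun_lift(1)[of "bv 0", OF this] machine_fun_lift(2)[of "bv 0", OF this]]
  show ?thesis by (simp add: eval_eq lam_def nat_type_def)
qed

section \<open>Typing of evaluation and of the computability type\<close>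

lemma machine_type: "[] \<turnstile> machine 0 type"
proof -
  have "answer nothing_known fuel (CheckType [] (machine 0)) \<noteq> None"
    by (simp only: machine_defs otm_defs) (simp only: checker_simps)
  then show ?thesis by (rule check_type_typed[OF _ ctx_Nil])
qed

lemma lifting_type: "ctx \<Gamma> \<Longrightarrow> \<Gamma> \<turnstile> lifting nat_type 0 type"
proof -
  have "answer nothing_known fuel (CheckType [] (lifting nat_type 0)) \<noteq> None"
    by (simp only: lifting_def otm_defs) (simp only: checker_simps)
  from weaken_closed_type[OF check_type_typed[OF this ctx_Nil]]
  show "ctx \<Gamma> \<Longrightarrow> \<Gamma> \<turnstile> lifting nat_type 0 type" .
qed

lemma Nat_type: "ctx \<Gamma> \<Longrightarrow> \<Gamma> \<turnstile> Nat type"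
  by (blast intro: type_El univ_Nat)

lemma Two_type: "ctx \<Gamma> \<Longrightarrow> \<Gamma> \<turnstile> Two type"
  by (blast intro: type_El univ_Two)

abbreviation NN :: tm where "NN \<equiv> Pi Nat Nat"
abbreviation N2 :: tm where "N2 \<equiv> Pi Nat Two"
abbreviation NL :: tm where "NL \<equiv> Pi Nat (lifting nat_type 0)"

lemma NN_type: "ctx \<Gamma> \<Longrightarrow> \<Gamma> \<turnstile> NN type"
  by (blast intro: Nat_type type_Pi ctx_Cons)

lemma N2_type: "ctx \<Gamma> \<Longrightarrow> \<Gamma> \<turnstile> N2 type"
  by (blast intro: Nat_type Two_type type_Pi ctx_Cons)

lemma NL_type: "ctx \<Gamma> \<Longrightarrow> \<Gamma> \<turnstile> NL type"
  by (blast intro: Nat_type lifting_type type_Pi ctx_Cons)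

lemma lift_lifting [simp]: "lift k (lifting nat_type 0) = lifting nat_type 0"
  using scoped(2)[OF lifting_type[OF ctx_Nil]] by simp

lemma subst_lifting [simp]: "subst k u (lifting nat_type 0) = lifting nat_type 0"
  using scoped_subst_type[OF lifting_type[OF ctx_Nil]] by simp

lemma eval_typed: "[machine 0] \<turnstile> eval (bv 0) (Suc 0) : NL"
proof -
  let ?M = "machine 0" and ?i = "machine_init (bv 0) (Suc 0)" and ?s = "machine_step (bv 0) (Suc 0)"
  have M: "ctx [?M]" using machine_type by (rule ctx_Cons)
  have "answer nothing_known fuel (Infer [?M] ?i) = Some NN"
    by (simp only: machine_defs otm_defs) (simp only: checker_simps)
  from infer_typed[OF this M] have i: "[?M] \<turnstile> ?i : NN" .
  have "answer nothing_known fuel (Infer [?M] ?s) = Some NN"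
    by (simp only: machine_defs otm_defs) (simp only: checker_simps)
  from infer_typed[OF this M] have s: "[?M] \<turnstile> ?s : NN" .
  have "answer nothing_known fuel (Check [Nat, NN, NN] eval_body (lifting nat_type 0)) \<noteq> None"
    by (simp only: eval_at_def extent_defs otm_defs) (simp only: checker_simps)
  from check_typed[OF this lifting_type] have b: "[Nat, NN, NN] \<turnstile> eval_body : lifting nat_type 0"
    by (blast intro: ctx_Cons Nat_type NN_type ctx_Nil)
  \<comment> \<open>The body was checked over two arbitrary functions and an input. The machine is
    inserted outermost, and its own two functions are then substituted.\<close>
  have "weakening (Suc (Suc (Suc 0))) [Nat, NN, NN] [Nat, NN, NN, ?M]"
    using weakening_Suc[OF weakening_Suc[OF weakening_Suc[OF weakening_0[OF machine_type],
      of NN], of NN], of Nat] by simp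
  note b = weakening_lift(3)[OF b this]
  have "substitution (Suc (Suc 0)) (lift 0 (lift 0 ?i)) [Nat, NN, NN, ?M] [Nat, NN, ?M]"
    using substitution_Suc[OF substitution_Suc[OF substitution_0[OF i], of NN], of Nat] by simp
  note b = substitution_subst(3)[OF b this]
  have "substitution (Suc 0) (lift 0 ?s) [Nat, NN, ?M] [Nat, ?M]"
    using substitution_Suc[OF substitution_0[OF s], of Nat] by simp
  note b = substitution_subst(3)[OF b this]
  show ?thesis unfolding eval_subst using Pi_intro[OF Nat_type[OF M] b] by simp
qed

definition computable :: "tm \<Rightarrow> tm" where
  "computable g = Sig (machine 0) (Eq NL (lift 0 g) (eval (bv 0) (Suc 0)))"

lemma nat_type_at: "nat_type n = Nat"
  by (simp add: nat_type_def)

lemma is_computable_eq: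
  "g (Suc n) = lift 0 (g n) \<Longrightarrow> is_computable g n = Trunc (computable (g n))"
  unfolding is_computable_def computable_def
  by (simp add: trunc_def sig_def eq_def arr_def pi_def nat_type_at machine_index[of n]
    eval_index[of n] lifting_index[of "Suc (Suc n)"])

lemma lift_computable [simp]: "lift k (computable g) = computable (lift k g)"
  using scoped(2)[OF machine_type, of k] scoped(3)[OF eval_typed, of "Suc k"]
  by (simp add: computable_def lift_lift)

lemma subst_computable [simp]: "subst k u (computable g) = computable (subst k u g)"
  using scoped_subst_type[OF machine_type, of k] scoped_subst_term[OF eval_typed, of "Suc k"]
  by (simp add: computable_def subst_lift_le)

lemma computable_type:
  assumes "\<Gamma> \<turnstile> g : NL"
  shows "\<Gamma> \<turnstile> computable g type"
proof -
  have \<Gamma>: "ctx \<Gamma>" using term_ctx[OF assms] .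
  have M: "\<Gamma> \<turnstile> machine 0 type" using weaken_closed_type[OF machine_type \<Gamma>] .
  from type_Sig[OF M type_Eq[OF NL_type[OF ctx_Cons[OF M]]]] lift_term[OF M assms]
    weaken_closed1[OF eval_typed \<Gamma>]
  show ?thesis by (simp add: computable_def)
qed

lemma computable_conv: "g \<approx> g' \<Longrightarrow> computable g \<approx> computable g'"
  unfolding computable_def by (intro cong_Sig cong_Eq conv.refl conv_lift)

abbreviation eta_nat :: tm where
  "eta_nat \<equiv> lam nat_type (\<lambda>n. eta (bv 0 \<cdot> n)) (Suc 0)"
abbreviation eta_two :: tm where
  "eta_two \<equiv> lam nat_type (\<lambda>n. eta (two_to_nat (bv 0 \<cdot> n))) (Suc 0)"
abbreviation nat_of_two :: tm where
  "nat_of_two \<equiv> lam nat_type (\<lambda>n. two_to_nat (bv 0 \<cdot> n)) (Suc 0)"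

lemma eta_nat_typed: "[NN] \<turnstile> eta_nat : NL"
proof -
  have "answer nothing_known fuel (Check [NN] eta_nat NL) \<noteq> None"
    by (simp only: extent_defs otm_defs) (simp only: checker_simps)
  from check_typed[OF this] show ?thesis by (blast intro: NL_type ctx_Cons NN_type ctx_Nil)
qed

lemma eta_two_typed: "[N2] \<turnstile> eta_two : NL"
proof -
  have "answer nothing_known fuel (Check [N2] eta_two NL) \<noteq> None"
    by (simp only: extent_defs otm_defs) (simp only: checker_simps)
  from check_typed[OF this] show ?thesis by (blast intro: NL_type ctx_Cons N2_type ctx_Nil)
qed

lemma nat_of_two_typed: "[N2] \<turnstile> nat_of_two : NN"
proof -
  have "answer nothing_known fuel (Check [N2] nat_of_two NN) \<noteq> None"
    by (simp only: extent_defs otm_defs) (simp only: checker_simps)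
  from check_typed[OF this] show ?thesis by (blast intro: NN_type ctx_Cons N2_type ctx_Nil)
qed

definition computable_two :: "tm \<Rightarrow> tm" where
  "computable_two a = computable (inst eta_two a)"

lemma lift_computable_two: "lift k (computable_two a) = computable_two (lift k a)"
  by (simp add: computable_two_def lift_inst1[OF eta_two_typed])

lemma subst_computable_two: "subst k u (computable_two a) = computable_two (subst k u a)"
  by (simp add: computable_two_def subst_inst1[OF eta_two_typed])

lemma shift_computable_two: "shift m k (computable_two a) = computable_two (shift m k a)"
  by (induction m) (simp_all add: shift_0 lift_computable_two flip: lift_shift)

lemma computable_two_type: "\<Gamma> \<turnstile> a : N2 \<Longrightarrow> \<Gamma> \<turnstile> computable_two a type"
  using computable_type[of \<Gamma> "inst eta_two a"] inst1_typed[OF eta_two_typed]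
  by (simp add: computable_two_def)

text \<open>The hypothesis is restricted to \<open>n \<le> k\<close> because a bound variable
  \<open>bv l\<close> satisfies it only in contexts that contain it: below that length the truncated
  subtraction of indices breaks it.\<close>

lemma is_computable_two_eq:
  assumes "\<And>k. n \<le> k \<Longrightarrow> f (Suc k) = lift 0 (f k)"
  shows "is_computable_two f n = Trunc (computable_two (f n))"
  unfolding is_computable_two_def computable_two_def
  by (subst is_computable_eq)
    (simp_all add: lam_def nat_type_def eta_def pair_def unit_def unit_is_prop_def two_to_nat_def
      two_elim_def zero_def succ_def app_def bv_def assms unit_elim_def eq_def star_def rfl_def lift_lift)

lemma church_thesis_eq: "church_thesis 0 = Pi NN (Trunc (computable (inst eta_nat (Var 0))))"
  unfolding church_thesis_def is_computable_total_def pi_def arr_def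
  by (subst is_computable_eq)
    (simp_all add: lam_def nat_type_def eta_def pair_def unit_def unit_is_prop_def app_def bv_def
      unit_elim_def eq_def star_def rfl_def)

lemma church_thesis_type: "[] \<turnstile> church_thesis 0 type"
proof -
  have N: "[] \<turnstile> NN type" by (rule NN_type[OF ctx_Nil])
  from var[OF ctx_Cons[OF N], of 0] have "[NN] \<turnstile> Var 0 : NN" by simp
  from type_Pi[OF N type_Trunc[OF computable_type]] inst1_typed[OF eta_nat_typed this]
  show ?thesis by (simp add: church_thesis_eq)
qed


section \<open>Propositions and equivalences inside the type theory\<close>

definition inhabited :: "otm \<Rightarrow> bool" where
  "inhabited A \<longleftrightarrow> (\<exists>t. [] \<turnstile> t : A 0)"

lemma inhabitedI:
  assumes "answer nothing_known n (CheckType [] (A 0)) \<noteq> None"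
    and "answer nothing_known n (Check [] (t 0) (A 0)) \<noteq> None"
  shows "inhabited A"
  unfolding inhabited_def using check_typed[OF assms(2) check_type_typed[OF assms(1) ctx_Nil]] by blast

definition fun_ext :: "otm \<Rightarrow> otm" where
  "fun_ext h = (\<lambda>n. FunExt (h n))"

definition prop_ext :: "otm \<Rightarrow> otm \<Rightarrow> otm \<Rightarrow> otm \<Rightarrow> otm" where
  "prop_ext p q f g = (\<lambda>n. PropExt (p n) (q n) (f n) (g n))"

text \<open>A type annotation, for terms whose type the checker cannot infer.\<close>

definition ann :: "otm \<Rightarrow> otm \<Rightarrow> otm" where
  "ann A a = lam A (\<lambda>x. x) \<cdot> a"

text \<open>\<open>eq_sym A a p : b = a\<close> for \<open>p : a = b\<close>\<close>

definition eq_sym :: "otm \<Rightarrow> otm \<Rightarrow> otm \<Rightarrow> otm" where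
  "eq_sym A a p = transport (\<lambda>x. eq A x a) (rfl a) p"

text \<open>\<open>eq_trans A a p q : a = c\<close> for \<open>p : a = b\<close> and \<open>q : b = c\<close>\<close>

definition eq_trans :: "otm \<Rightarrow> otm \<Rightarrow> otm \<Rightarrow> otm \<Rightarrow> otm" where
  "eq_trans A a p q = transport (\<lambda>x. eq A a x) p q"

text \<open>\<open>eq_linv A a p : rfl b = eq_trans A b (eq_sym A a p) p\<close> for \<open>p : a = b\<close>\<close>

definition eq_linv :: "otm \<Rightarrow> otm \<Rightarrow> otm \<Rightarrow> otm" where
  "eq_linv A a p = eq_elim (\<lambda>x p. eq (eq A x x) (rfl x) (eq_trans A x (eq_sym A a p) p))
     (rfl (rfl a)) p"

text \<open>
  \<open>eq_prop : \<Pi>A. is_prop A \<rightarrow> \<Pi>x y. is_prop (eq A x y)\<close>. By path induction, every \<open>p : x = z\<close> equals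
  the composite of \<open>(h x x)\<^sup>-\<^sup>1\<close> and \<open>h x z\<close>, where \<open>h : is_prop A\<close>.
\<close>

definition eq_prop :: otm where
  "eq_prop = lam univ (\<lambda>A. lam (is_prop A) (\<lambda>h. lam A (\<lambda>x. lam A (\<lambda>y.
     lam (eq A x y) (\<lambda>p. lam (eq A x y) (\<lambda>q.
       let K = eq_sym A x (h \<cdot> x \<cdot> x);
           F = (\<lambda>p. eq_elim (\<lambda>z p. eq (eq A x z) p (eq_trans A x K (h \<cdot> x \<cdot> z)))
                 (eq_linv A x (h \<cdot> x \<cdot> x)) p)
       in eq_trans (eq A x y) p (F p) (eq_sym (eq A x y) q (F q))))))))"

text \<open>\<open>pi_prop : \<Pi>A B. (\<Pi>a. is_prop (B a)) \<rightarrow> is_prop (\<Pi>a. B a)\<close>\<close>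

definition pi_prop :: otm where
  "pi_prop = lam univ (\<lambda>A. lam (A \<rightarrow> univ) (\<lambda>B. lam (pi A (\<lambda>a. is_prop (B \<cdot> a))) (\<lambda>h.
     lam (pi A (\<lambda>a. B \<cdot> a)) (\<lambda>f. lam (pi A (\<lambda>a. B \<cdot> a)) (\<lambda>g.
       ann (eq (pi A (\<lambda>a. B \<cdot> a)) f g)
         (fun_ext (lam A (\<lambda>a. h \<cdot> a \<cdot> (f \<cdot> a) \<cdot> (g \<cdot> a)))))))))"

text \<open>\<open>sig_prop : \<Pi>A B. is_prop A \<rightarrow> (\<Pi>a. is_prop (B a)) \<rightarrow> is_prop (\<Sigma>a. B a)\<close>\<close>

definition sig_prop :: otm where
  "sig_prop = lam univ (\<lambda>A. lam (A \<rightarrow> univ) (\<lambda>B.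
     lam (is_prop A) (\<lambda>h. lam (pi A (\<lambda>a. is_prop (B \<cdot> a))) (\<lambda>k.
       let S = sig A (\<lambda>a. B \<cdot> a) in
       lam S (\<lambda>p. lam S (\<lambda>q.
         sig_elim (\<lambda>p. eq S p q) (lam A (\<lambda>a. lam (B \<cdot> a) (\<lambda>b.
           sig_elim (\<lambda>q. eq S (pair a b) q) (lam A (\<lambda>a'. lam (B \<cdot> a') (\<lambda>b'.
             transport (\<lambda>w. pi (B \<cdot> w) (\<lambda>r. eq S (pair a b) (pair w r)))
               (lam (B \<cdot> a) (\<lambda>r.
                 transport (\<lambda>r. eq S (pair a b) (pair a r)) (rfl (pair a b)) (k \<cdot> a \<cdot> b \<cdot> r)))
               (h \<cdot> a \<cdot> a') \<cdot> b'))) q))) p))))))"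

definition section_of :: "otm \<Rightarrow> otm \<Rightarrow> otm \<Rightarrow> otm" where
  "section_of P Q f = sig (Q \<rightarrow> P) (\<lambda>g. pi Q (\<lambda>y. eq Q (f \<cdot> (g \<cdot> y)) y))"

definition retraction_of :: "otm \<Rightarrow> otm \<Rightarrow> otm \<Rightarrow> otm" where
  "retraction_of P Q f = sig (Q \<rightarrow> P) (\<lambda>k. pi P (\<lambda>x. eq P (k \<cdot> (f \<cdot> x)) x))"

text \<open>\<open>equiv_elim C b P Q e : C\<close> where \<open>b f k s : C\<close> for a map \<open>f\<close> with retraction \<open>k\<close>.\<close>

definition equiv_elim :: "otm \<Rightarrow> (otm \<Rightarrow> otm \<Rightarrow> otm \<Rightarrow> otm) \<Rightarrow> otm \<Rightarrow> otm \<Rightarrow> otm \<Rightarrow> otm" where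
  "equiv_elim C b P Q e =
     sig_elim (\<lambda>_. C) (lam (P \<rightarrow> Q) (\<lambda>f. lam (section_of P Q f \<otimes> retraction_of P Q f) (\<lambda>w.
       sig_elim (\<lambda>_. C) (lam (section_of P Q f) (\<lambda>u. lam (retraction_of P Q f) (\<lambda>v.
         sig_elim (\<lambda>_. C) (lam (Q \<rightarrow> P) (\<lambda>k. lam (pi P (\<lambda>x. eq P (k \<cdot> (f \<cdot> x)) x)) (\<lambda>s.
           b f k s))) v))) w))) e"

text \<open>\<open>equiv_prop_left : \<Pi>P Q. is_prop Q \<rightarrow> (P \<simeq> Q) \<rightarrow> is_prop P\<close>\<close>

definition equiv_prop_left :: otm where
  "equiv_prop_left = lam univ (\<lambda>P. lam univ (\<lambda>Q. lam (is_prop Q) (\<lambda>h. lam (P \<simeq> Q) (\<lambda>e.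
     equiv_elim (is_prop P) (\<lambda>f k s. lam P (\<lambda>x. lam P (\<lambda>y.
       eq_trans P x (eq_sym P (k \<cdot> (f \<cdot> x)) (s \<cdot> x))
         (eq_trans P (k \<cdot> (f \<cdot> x))
           (transport (\<lambda>z. eq P (k \<cdot> (f \<cdot> x)) (k \<cdot> z)) (rfl (k \<cdot> (f \<cdot> x)))
             (h \<cdot> (f \<cdot> x) \<cdot> (f \<cdot> y)))
           (s \<cdot> y))))) P Q e))))"

definition equiv_to_eq_type :: otm where
  "equiv_to_eq_type = pi univ (\<lambda>P. pi univ (\<lambda>Q. is_prop Q \<rightarrow> (P \<simeq> Q) \<rightarrow> eq univ P Q))"

text \<open>\<open>P\<close> is a proposition as a retract of \<open>Q\<close>, so proposition
  extensionality applies to the map and its retraction.\<close>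

definition equiv_to_eq :: otm where
  "equiv_to_eq = lam univ (\<lambda>P. lam univ (\<lambda>Q. lam (is_prop Q) (\<lambda>h. lam (P \<simeq> Q) (\<lambda>e.
     equiv_elim (eq univ P Q)
       (\<lambda>f k s. prop_ext (equiv_prop_left \<cdot> P \<cdot> Q \<cdot> h \<cdot> e) h f k) P Q e))))"

definition eq_to_equiv_type :: otm where
  "eq_to_equiv_type = pi univ (\<lambda>P. pi univ (\<lambda>Q. eq univ P Q \<rightarrow> (P \<simeq> Q)))"

definition eq_to_equiv :: otm where
  "eq_to_equiv = lam univ (\<lambda>P. lam univ (\<lambda>Q. lam (eq univ P Q) (\<lambda>p.
     let i = lam P (\<lambda>x. x); r = lam P (\<lambda>x. rfl x)
     in transport (\<lambda>X. P \<simeq> X) (pair i (pair (pair i r) (pair i r))) p)))"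

definition equiv_prop_type :: otm where
  "equiv_prop_type = pi univ (\<lambda>P. pi univ (\<lambda>Q. is_prop Q \<rightarrow> is_prop (P \<simeq> Q)))"

text \<open>To identify two equivalences, the first may be used: it makes \<open>P\<close> a
  proposition too. Then all function types and identity types in the nested sum are small
  propositions, and \<open>pi_prop\<close> and \<open>sig_prop\<close> assemble them.\<close>

definition equiv_prop :: otm where
  "equiv_prop = lam univ (\<lambda>P. lam univ (\<lambda>Q. lam (is_prop Q) (\<lambda>h. lam (P \<simeq> Q) (\<lambda>e.
     let p = equiv_prop_left \<cdot> P \<cdot> Q \<cdot> h \<cdot> e;
         b = pi_prop \<cdot> Q \<cdot> lam Q (\<lambda>_. P) \<cdot> lam Q (\<lambda>_. p)
     in sig_prop \<cdot> (P \<rightarrow> Q) \<cdot> lam (P \<rightarrow> Q) (\<lambda>f. is_equiv P Q f)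
          \<cdot> (pi_prop \<cdot> P \<cdot> lam P (\<lambda>_. Q) \<cdot> lam P (\<lambda>_. h))
          \<cdot> lam (P \<rightarrow> Q) (\<lambda>f.
              sig_prop \<cdot> section_of P Q f \<cdot> lam (section_of P Q f) (\<lambda>_. retraction_of P Q f)
              \<cdot> (sig_prop \<cdot> (Q \<rightarrow> P) \<cdot> lam (Q \<rightarrow> P) (\<lambda>g. pi Q (\<lambda>y. eq Q (f \<cdot> (g \<cdot> y)) y)) \<cdot> b
                  \<cdot> lam (Q \<rightarrow> P) (\<lambda>g. pi_prop \<cdot> Q \<cdot> lam Q (\<lambda>y. eq Q (f \<cdot> (g \<cdot> y)) y)
                      \<cdot> lam Q (\<lambda>y. eq_prop \<cdot> Q \<cdot> h \<cdot> (f \<cdot> (g \<cdot> y)) \<cdot> y)))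
              \<cdot> lam (section_of P Q f) (\<lambda>_.
                  sig_prop \<cdot> (Q \<rightarrow> P) \<cdot> lam (Q \<rightarrow> P) (\<lambda>k. pi P (\<lambda>x. eq P (k \<cdot> (f \<cdot> x)) x)) \<cdot> b
                  \<cdot> lam (Q \<rightarrow> P) (\<lambda>k. pi_prop \<cdot> P \<cdot> lam P (\<lambda>x. eq P (k \<cdot> (f \<cdot> x)) x)
                      \<cdot> lam P (\<lambda>x. eq_prop \<cdot> P \<cdot> p \<cdot> (k \<cdot> (f \<cdot> x)) \<cdot> x))))
          \<cdot> e))))"

text \<open>\<open>prop_prop : \<Pi>P. is_prop (is_prop P)\<close>\<close>

definition prop_prop :: otm where
  "prop_prop = lam univ (\<lambda>P. lam (is_prop P) (\<lambda>h. lam (is_prop P) (\<lambda>q.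
     ann (eq (is_prop P) h q) (fun_ext (lam P (\<lambda>x. fun_ext (lam P (\<lambda>y.
       eq_prop \<cdot> P \<cdot> h \<cdot> x \<cdot> y \<cdot> (h \<cdot> x \<cdot> y) \<cdot> (q \<cdot> x \<cdot> y)))))))))"

definition eq_univ_prop_type :: otm where
  "eq_univ_prop_type = pi univ (\<lambda>P. pi univ (\<lambda>Q. is_prop Q \<rightarrow> is_prop (eq univ P Q)))"

text \<open>
  Let \<open>p : is_prop P\<close> and \<open>K = prop_ext p p id id\<close>. By path induction, every \<open>e : P = R\<close> equals
  \<open>K\<^sup>-\<^sup>1\<close> followed by \<open>prop_ext p q f g\<close>, for all \<open>q : is_prop R\<close>, \<open>f : P \<rightarrow> R\<close> and \<open>g : R \<rightarrow> P\<close>: when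
  \<open>R\<close> is \<open>P\<close>, the types of \<open>q\<close>, \<open>f\<close> and \<open>g\<close> are propositions, so \<open>prop_ext p q f g = K\<close>. The composite
  does not mention \<open>e\<close>.
\<close>

definition eq_univ_prop :: otm where
  "eq_univ_prop = lam univ (\<lambda>P. lam univ (\<lambda>Q. lam (is_prop Q) (\<lambda>h.
     lam (eq univ P Q) (\<lambda>e. lam (eq univ P Q) (\<lambda>e'.
       let p = transport is_prop h (eq_sym univ P e);
           i = lam P (\<lambda>x. x);
           X = (\<lambda>R q f g. ann (eq univ P R) (prop_ext p q f g));
           K = X P p i i;
           T = (\<lambda>R e q f g. eq (eq univ P R) e (eq_trans univ P (eq_sym univ P K) (X R q f g)));
           unique = pi_prop \<cdot> P \<cdot> lam P (\<lambda>_. P) \<cdot> lam P (\<lambda>_. p);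
           base = lam (is_prop P) (\<lambda>q. lam (P \<rightarrow> P) (\<lambda>f. lam (P \<rightarrow> P) (\<lambda>g.
             transport (\<lambda>g. T P (rfl P) q f g)
               (transport (\<lambda>f. T P (rfl P) q f i)
                 (transport (\<lambda>q. T P (rfl P) q i i) (eq_linv univ P K) (prop_prop \<cdot> P \<cdot> p \<cdot> q))
                 (unique \<cdot> i \<cdot> f))
               (unique \<cdot> i \<cdot> g))));
           M = (\<lambda>e'. eq_elim (\<lambda>R e.
                   pi (is_prop R) (\<lambda>q. pi (P \<rightarrow> R) (\<lambda>f. pi (R \<rightarrow> P) (\<lambda>g. T R e q f g)))) base e'
                 \<cdot> h \<cdot> transport (\<lambda>X. P \<rightarrow> X) i e \<cdot> transport (\<lambda>X. X \<rightarrow> P) i e)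
       in eq_trans (eq univ P Q) e (M e) (eq_sym (eq univ P Q) e' (M e')))))))"

lemmas prop_type_defs =
  equiv_to_eq_type_def eq_to_equiv_type_def equiv_prop_type_def eq_univ_prop_type_def

lemmas prop_term_defs = fun_ext_def prop_ext_def ann_def eq_sym_def eq_trans_def eq_linv_def
  eq_prop_def pi_prop_def sig_prop_def section_of_def retraction_of_def equiv_elim_def
  equiv_prop_left_def equiv_to_eq_def eq_to_equiv_def equiv_prop_def prop_prop_def eq_univ_prop_def

lemma equiv_to_eq_inhabited: "inhabited equiv_to_eq_type"
  by (rule inhabitedI[of fuel _ equiv_to_eq])
    (simp only: prop_type_defs prop_term_defs otm_defs, simp only: checker_simps)+

lemma eq_to_equiv_inhabited: "inhabited eq_to_equiv_type"
  by (rule inhabitedI[of fuel _ eq_to_equiv])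
    (simp only: prop_type_defs prop_term_defs otm_defs, simp only: checker_simps)+

lemma equiv_prop_inhabited: "inhabited equiv_prop_type"
  by (rule inhabitedI[of fuel _ equiv_prop])
    (simp only: prop_type_defs prop_term_defs otm_defs, simp only: checker_simps)+

lemma eq_univ_prop_inhabited: "inhabited eq_univ_prop_type"
  by (rule inhabitedI[of fuel _ eq_univ_prop])
    (simp only: prop_type_defs prop_term_defs otm_defs, simp only: checker_simps)+


section \<open>The equivalence\<close>

text \<open>
  For a family \<open>S\<close> of types indexed by binary sequences, \<open>semi_dec S\<close> is \<open>semi_decision\<close> with
  computability of \<open>f\<close> replaced by the truncation of \<open>S f\<close>.
\<close>

definition truncated :: "(tm \<Rightarrow> tm) \<Rightarrow> otm \<Rightarrow> otm" where
  "truncated S f = trunc (\<lambda>n. S (f n))"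

definition binary_seq :: otm where
  "binary_seq = nat_type \<rightarrow> two"

definition semi_dec_rest :: "(tm \<Rightarrow> tm) \<Rightarrow> otm \<Rightarrow> otm \<Rightarrow> otm" where
  "semi_dec_rest S P f = truncated S f \<otimes> (P \<simeq> \<langle>f\<rangle>)"

definition semi_dec :: "(tm \<Rightarrow> tm) \<Rightarrow> otm \<Rightarrow> otm" where
  "semi_dec S P = sig binary_seq (\<lambda>f. is_prop \<langle>f\<rangle> \<otimes> semi_dec_rest S P f)"

definition infty_seq :: "otm \<Rightarrow> otm" where
  "infty_seq u = proj1 binary_seq (\<lambda>f. is_prop \<langle>f\<rangle>) u"

text \<open>
  Below, \<open>to_eq\<close>, \<open>to_equiv\<close>, \<open>eq_unique\<close>, \<open>equiv_unique\<close> stand for terms of type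
  \<open>equiv_to_eq_type\<close>, \<open>eq_to_equiv_type\<close>, \<open>eq_univ_prop_type\<close>, \<open>equiv_prop_type\<close>, and \<open>c\<close> for a
  proof that every \<open>truncated S f\<close> is inhabited.
\<close>

definition to_ros :: "(tm \<Rightarrow> tm) \<Rightarrow> otm \<Rightarrow> otm \<Rightarrow> otm" where
  "to_ros S to_eq P = lam (semi_dec S P) (\<lambda>x. let R = rosolini_structure P in
     sig_elim (\<lambda>_. R) (lam binary_seq (\<lambda>f. lam (is_prop \<langle>f\<rangle> \<otimes> semi_dec_rest S P f) (\<lambda>r.
       sig_elim (\<lambda>_. R) (lam (is_prop \<langle>f\<rangle>) (\<lambda>h. lam (semi_dec_rest S P f) (\<lambda>r.
         sig_elim (\<lambda>_. R) (lam (truncated S f) (\<lambda>_. lam (P \<simeq> \<langle>f\<rangle>) (\<lambda>e.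
           pair (pair f h) (to_eq \<cdot> P \<cdot> \<langle>f\<rangle> \<cdot> h \<cdot> e)))) r))) r))) x)"

text \<open>The motive of the split on \<open>u\<close> abstracts over the equation, because its
  type mentions \<open>infty_seq u\<close>, which reduces to \<open>f\<close> only when
  \<open>u\<close> is \<open>pair f h\<close>.\<close>

definition from_ros :: "(tm \<Rightarrow> tm) \<Rightarrow> otm \<Rightarrow> otm \<Rightarrow> otm \<Rightarrow> otm" where
  "from_ros S to_equiv c P = lam (rosolini_structure P) (\<lambda>y.
     sig_elim (\<lambda>_. semi_dec S P) (lam nat_infty (\<lambda>u.
       sig_elim (\<lambda>u. eq univ P \<langle>infty_seq u\<rangle> \<rightarrow> semi_dec S P)
         (lam binary_seq (\<lambda>f. lam (is_prop \<langle>f\<rangle>) (\<lambda>h. lam (eq univ P \<langle>f\<rangle>) (\<lambda>q.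
           pair f (pair h (pair (c \<cdot> f) (to_equiv \<cdot> P \<cdot> \<langle>f\<rangle> \<cdot> q))))))) u)) y)"

text \<open>Without eta for pairs the two maps compute only on explicit pairs. After the splits the
  round trip changes nothing but the equality proof, which \<open>eq_unique\<close> repairs.\<close>

definition to_ros_from_ros :: "(tm \<Rightarrow> tm) \<Rightarrow> otm \<Rightarrow> otm \<Rightarrow> otm \<Rightarrow> otm \<Rightarrow> otm \<Rightarrow> otm" where
  "to_ros_from_ros S to_eq to_equiv eq_unique c P = lam (rosolini_structure P) (\<lambda>y.
     let R = rosolini_structure P; t = (\<lambda>y. to_ros S to_eq P \<cdot> (from_ros S to_equiv c P \<cdot> y)) in
     sig_elim (\<lambda>y. eq R (t y) y) (lam nat_infty (\<lambda>u.
       sig_elim (\<lambda>u. pi (eq univ P \<langle>infty_seq u\<rangle>) (\<lambda>q. eq R (t (pair u q)) (pair u q)))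
         (lam binary_seq (\<lambda>f. lam (is_prop \<langle>f\<rangle>) (\<lambda>h. lam (eq univ P \<langle>f\<rangle>) (\<lambda>q.
           let q' = to_eq \<cdot> P \<cdot> \<langle>f\<rangle> \<cdot> h \<cdot> (to_equiv \<cdot> P \<cdot> \<langle>f\<rangle> \<cdot> q) in
           transport (\<lambda>w. eq R (pair (pair f h) q') (pair (pair f h) w)) (rfl (pair (pair f h) q'))
             (eq_unique \<cdot> P \<cdot> \<langle>f\<rangle> \<cdot> h \<cdot> q' \<cdot> q))))) u)) y)"

text \<open>The round trip replaces the computability proof by \<open>c \<cdot> f\<close> and the
  equivalence by one recovered from an equality. The inner transport repairs the former, the outer
  one the latter.\<close>

definition from_ros_to_ros :: "(tm \<Rightarrow> tm) \<Rightarrow> otm \<Rightarrow> otm \<Rightarrow> otm \<Rightarrow> otm \<Rightarrow> otm \<Rightarrow> otm" where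
  "from_ros_to_ros S to_eq to_equiv equiv_unique c P = lam (semi_dec S P) (\<lambda>x.
     let D = semi_dec S P; t = (\<lambda>x. from_ros S to_equiv c P \<cdot> (to_ros S to_eq P \<cdot> x)) in
     sig_elim (\<lambda>x. eq D (t x) x)
       (lam binary_seq (\<lambda>f. lam (is_prop \<langle>f\<rangle> \<otimes> semi_dec_rest S P f) (\<lambda>r.
         sig_elim (\<lambda>r. eq D (t (pair f r)) (pair f r))
           (lam (is_prop \<langle>f\<rangle>) (\<lambda>h. lam (semi_dec_rest S P f) (\<lambda>r.
             sig_elim (\<lambda>r. eq D (t (pair f (pair h r))) (pair f (pair h r)))
               (lam (truncated S f) (\<lambda>a. lam (P \<simeq> \<langle>f\<rangle>) (\<lambda>e.
                 let e' = to_equiv \<cdot> P \<cdot> \<langle>f\<rangle> \<cdot> (to_eq \<cdot> P \<cdot> \<langle>f\<rangle> \<cdot> h \<cdot> e);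
                     d = (\<lambda>a e. pair f (pair h (pair a e))) in
                 transport (\<lambda>w. eq D (d (c \<cdot> f) e') (d a w))
                   (transport (\<lambda>w. eq D (d (c \<cdot> f) e') (d w e')) (rfl (d (c \<cdot> f) e'))
                     (trunc_prop (\<lambda>n. S (f n)) \<cdot> (c \<cdot> f) \<cdot> a))
                   (equiv_unique \<cdot> P \<cdot> \<langle>f\<rangle> \<cdot> h \<cdot> e' \<cdot> e)))) r))) r))) x)"

definition semi_dec_equiv_type :: "(tm \<Rightarrow> tm) \<Rightarrow> otm" where
  "semi_dec_equiv_type S = pi univ (\<lambda>P. semi_dec S P \<simeq> rosolini_structure P)"

text \<open>The four facts about propositions enter as hypotheses, so that the checker meets
  variables instead of their large proof terms; \<open>inhabited_mp\<close> discharges them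
  afterwards.\<close>

definition main_type :: "(tm \<Rightarrow> tm) \<Rightarrow> otm" where
  "main_type S = equiv_to_eq_type \<rightarrow> eq_to_equiv_type \<rightarrow> equiv_prop_type \<rightarrow> eq_univ_prop_type \<rightarrow>
     pi binary_seq (truncated S) \<rightarrow> semi_dec_equiv_type S"

definition main_term :: "(tm \<Rightarrow> tm) \<Rightarrow> otm" where
  "main_term S = lam equiv_to_eq_type (\<lambda>to_eq. lam eq_to_equiv_type (\<lambda>to_equiv.
     lam equiv_prop_type (\<lambda>equiv_unique. lam eq_univ_prop_type (\<lambda>eq_unique.
       lam (pi binary_seq (truncated S)) (\<lambda>c. lam univ (\<lambda>P.
         pair (to_ros S to_eq P)
           (pair
             (pair (from_ros S to_equiv c P) (to_ros_from_ros S to_eq to_equiv eq_unique c P))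
             (pair (from_ros S to_equiv c P) (from_ros_to_ros S to_eq to_equiv equiv_unique c P)))))))))"

lemmas main_defs = main_term_def main_type_def semi_dec_equiv_type_def binary_seq_def truncated_def
  semi_dec_def semi_dec_rest_def infty_seq_def to_ros_def from_ros_def to_ros_from_ros_def
  from_ros_to_ros_def prop_type_defs angle_def nat_infty_def rosolini_structure_def

text \<open>Recognising variables is enough, since the truncated family is formed only on bound
  sequences when \<open>main_term\<close> is checked.\<close>

definition known_computable :: "tm list \<Rightarrow> tm \<Rightarrow> bool" where
  "known_computable \<Gamma> T \<longleftrightarrow> (\<exists>i. T = computable_two (Var i) \<and> lookup 1 \<Gamma> i = Some N2)"

lemma known_computable_type:
  assumes "ctx \<Gamma>"
  shows "known_computable \<Gamma> \<le> is_type \<Gamma>"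
proof (rule predicate1I)
  fix T assume "known_computable \<Gamma> T"
  then obtain i where T: "T = computable_two (Var i)" and l: "lookup 1 \<Gamma> i = Some N2"
    by (auto simp: known_computable_def)
  from lookup_Some[OF l] var[OF assms, of i] have "\<Gamma> \<turnstile> Var i : N2" by simp
  then show "\<Gamma> \<turnstile> T type" unfolding T by (rule computable_two_type)
qed

lemma known_computable_two:
  "lookup (Suc 0) \<Gamma> i = Some N2 \<Longrightarrow> known_computable \<Gamma> (computable_two (Var i))"
  by (auto simp: known_computable_def)

lemmas opaque_simps =
  lift_computable_two subst_computable_two shift_computable_two known_computable_two

lemma main_inhabited: "inhabited (main_type computable_two)"
proof -
  have "answer known_computable fuel (CheckType [] (main_type computable_two 0)) \<noteq> None"
    by (simp only: main_defs otm_defs) (simp only: checker_simps opaque_simps)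
  then have T: "[] \<turnstile> main_type computable_two 0 type"
    using answer_sound[of known_computable] known_computable_type ctx_Nil by fastforce
  have "answer known_computable fuel
      (Check [] (main_term computable_two 0) (main_type computable_two 0)) \<noteq> None"
    by (simp only: main_defs otm_defs) (simp only: checker_simps opaque_simps)
  then have "[] \<turnstile> main_term computable_two 0 : main_type computable_two 0"
    using answer_sound[of known_computable] known_computable_type T by fastforce
  then show ?thesis by (auto simp: inhabited_def)
qed

section \<open>Assembling the theorem\<close>

lemma semi_decision_eq: "semi_decision P = semi_dec computable_two P"
  by (simp add: semi_decision_def semi_dec_def semi_dec_rest_def binary_seq_def truncated_def
    prod_type_def sig_def is_computable_two_eq bv_def trunc_def fun_eq_iff Suc_diff_le)

lemma church_thesis_computable_two:
  "inhabited (church_thesis \<rightarrow> pi binary_seq (truncated computable_two))"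
proof -
  let ?\<Gamma> = "[N2, church_thesis 0]" and ?t = "App (Var (Suc 0)) nat_of_two"
  have N2: "[church_thesis 0] \<turnstile> N2 type" by (rule N2_type[OF ctx_Cons[OF church_thesis_type]])
  have \<Gamma>: "ctx ?\<Gamma>" using N2 by (rule ctx_Cons)
  from var[OF \<Gamma>, of 1] have "?\<Gamma> \<turnstile> Var (Suc 0) : church_thesis 0"
    using scoped(2)[OF church_thesis_type, of 0] by simp
  moreover have "?\<Gamma> \<turnstile> nat_of_two : NN"
    using weaken_closed1[OF nat_of_two_typed ctx_Cons[OF church_thesis_type]] .
  ultimately have "?\<Gamma> \<turnstile> ?t : inst (Trunc (computable (inst eta_nat (Var 0)))) nat_of_two"
    unfolding church_thesis_eq by (rule Pi_elim)
  then have t: "?\<Gamma> \<turnstile> ?t : Trunc (computable (inst eta_nat nat_of_two))"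
    by (simp add: subst_inst1[OF eta_nat_typed])
  \<comment> \<open>Lifting the composite leaves a beta-redex that lifting the sequence directly
    does not have; the conversion test removes it under the binder.\<close>
  have "conv_check fuel (inst eta_nat nat_of_two) (inst eta_two (Var 0))"
    by (simp only: extent_defs otm_defs) (simp only: checker_simps)
  then have conv: "Trunc (computable (inst eta_nat nat_of_two)) \<approx> Trunc (computable_two (Var 0))"
    unfolding computable_two_def by (intro cong_Trunc computable_conv conv_check_sound)
  from var[OF \<Gamma>, of 0] have "?\<Gamma> \<turnstile> Trunc (computable_two (Var 0)) type"
    by (intro type_Trunc computable_two_type) simp
  from Pi_intro[OF church_thesis_type Pi_intro[OF N2 conversion[OF t this conv]]] show ?thesis
    by (auto simp: inhabited_def arr_def pi_def binary_seq_def truncated_def trunc_def nat_type_def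
      two_def bv_def)
qed

text \<open>The codomain of \<open>A \<rightarrow> B\<close> is read in a context one longer.
  Coherence says that this is the weakening of \<open>B\<close>, which instantiation cancels in an
  application.\<close>

definition coherent :: "otm \<Rightarrow> bool" where
  "coherent A \<longleftrightarrow> (\<forall>n. A (Suc n) = lift 0 (A n))"

lemma coherentI: "(\<And>n. A (n + Suc 0) = lift 0 (A (n + 0))) \<Longrightarrow> coherent A"
  by (simp add: coherent_def)

lemma coherent_arr: "coherent A \<Longrightarrow> coherent B \<Longrightarrow> coherent (A \<rightarrow> B)"
  by (simp add: coherent_def arr_def pi_def lift_lift)

lemma coherent_types:
  "coherent eq_to_equiv_type" "coherent equiv_prop_type" "coherent eq_univ_prop_type"
  "coherent (pi binary_seq (truncated computable_two))" "coherent (semi_dec_equiv_type computable_two)"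
  by (rule coherentI, simp only: main_defs otm_defs offset_simps,
      simp only: lift.simps index_simps lift_computable_two)+

lemma inhabited_mp:
  assumes "inhabited (A \<rightarrow> B)" "inhabited A" "coherent B"
  shows "inhabited B"
proof -
  from assms obtain f a where "[] \<turnstile> f : Pi (A 0) (lift 0 (B 0))" "[] \<turnstile> a : A 0"
    by (auto simp: inhabited_def arr_def pi_def coherent_def)
  from Pi_elim[OF this] show ?thesis by (auto simp: inhabited_def)
qed

lemma inhabited_trans:
  assumes "inhabited (A \<rightarrow> B)" "inhabited (B \<rightarrow> C)" "coherent B" "coherent C"
  shows "inhabited (A \<rightarrow> C)"
proof -
  from assms obtain f g
    where f: "[] \<turnstile> f : Pi (A 0) (lift 0 (B 0))" and g: "[] \<turnstile> g : Pi (B 0) (lift 0 (C 0))"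
    by (auto simp: inhabited_def arr_def pi_def coherent_def)
  have A: "[] \<turnstile> A 0 type" using Pi_type_inversion[OF validity[OF f]] by blast
  from lift_term[OF A f] var[OF ctx_Cons[OF A], of 0]
  have "[A 0] \<turnstile> App (lift 0 f) (Var 0) : inst (lift (Suc 0) (lift 0 (B 0))) (Var 0)"
    by (intro Pi_elim) simp_all
  then have fx: "[A 0] \<turnstile> App (lift 0 f) (Var 0) : lift 0 (B 0)" by (simp add: lift_lift)
  from lift_term[OF A g] have "[A 0] \<turnstile> lift 0 g : Pi (lift 0 (B 0)) (lift 0 (lift 0 (C 0)))"
    by (simp add: lift_lift)
  from Pi_elim[OF this fx] assms(4)
  have "[A 0] \<turnstile> App (lift 0 g) (App (lift 0 f) (Var 0)) : C (Suc 0)" by (simp add: coherent_def)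
  from Pi_intro[OF A this] show ?thesis by (auto simp: inhabited_def arr_def pi_def)
qed

theorem theorem9p11:
  shows "\<exists>t. [] \<turnstile> t :
    (church_thesis \<rightarrow> pi univ (\<lambda>P. semi_decision P \<simeq> rosolini_structure P)) 0"
proof -
  let ?C = "pi binary_seq (truncated computable_two)" and ?E = "semi_dec_equiv_type computable_two"
  have "inhabited (?C \<rightarrow> ?E)"
    using main_inhabited unfolding main_type_def
    by (blast intro: coherent_types coherent_arr
      inhabited_mp[OF inhabited_mp[OF inhabited_mp[OF inhabited_mp[OF _ equiv_to_eq_inhabited]
        eq_to_equiv_inhabited] equiv_prop_inhabited] eq_univ_prop_inhabited])
  with church_thesis_computable_two have "inhabited (church_thesis \<rightarrow> ?E)"
    by (rule inhabited_trans) (rule coherent_types)+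
  then show ?thesis by (simp add: inhabited_def semi_dec_equiv_type_def semi_decision_eq)
qed

end
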